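(* (a) Let conics $A$ and $B$ with matrices $M_A,M_B$ be given, let $F(z)=\det(M_A-zM_B)$ be a polynomial of degree three, and let $R(t)=t^4F(1/t)$, a polynomial of degree four. If the Poncelet problem for $A,B$ is periodic with an even period, then the Pell–Abel equation $P(t)^2-R(t)Q(t)^2=L^2$ is solvable. (b) Conversely, for any real polynomial $R$ of degree four without constant term (with $F(s)=s^4R(1/s)$ of degree three) one can build a pair of conics $A$ and $B$ whose polynomial $\det(M_A-zM_B)$ equals $F(z)$, so that the Poncelet problem for $A,B$ is periodic with an even period if the Pell–Abel equation $P(t)^2-R(t)Q(t)^2=L^2$ is solvable.
   Context: $M_A,M_B$ are nondegenerate $3\times3$ symmetric matrices of the quadratic forms defining the conics in homogeneous coordinates. Solvability of the Pell–Abel equation for a given $R$ means existence of polynomials $P,Q$ in one variable $t$ with $Q\not\equiv0$ and a constant $L$ satisfying the equation (complex coefficients allowed). Poncelet problem: start from a point $P_0\in B$ and a tangent line to $A$ through $P_0$; let $P_1$ be its second intersection with $B$; draw the second tangent to $A$ through $P_1$ (other than the line $P_0P_1$), let $P_2$ be its second intersection with $B$, and so on. It is periodic with period $N$ if every such trajectory is closed after $N$ steps, i.e. both $P_N=P_0$ and the tangent line at step $N$ returns to the initial one; $N$ is not required to be minimal. By Poncelet's theorem this does not depend on the initial point. If the conics or the trajectories are not real, the construction is considered over $\mathbb C$.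
   Formalization: In (a) the conics A and B are assumed distinct; for A = B every trajectory is constant, hence of period 2, while R is a constant times t(ct-1)^3 and the Pell–Abel equation has no solution. *)

theory Defs
  imports "HOL-Analysis.Analysis" "HOL-Computational_Algebra.Polynomial"
begin

text \<open>
  Points and lines of the complex projective plane are given by nonzero homogeneous coordinate
  vectors in \<^typ>\<open>complex ^ 3\<close>, considered up to \<open>proj_eq\<close>. All pairings below are the complex
  bilinear \<^const>\<open>scalar_product\<close>; the library's inner product on \<^typ>\<open>complex ^ 3\<close> is real-valued
  and not bilinear over the complex numbers.
\<close>

definition proj_eq :: "complex ^ 3 \<Rightarrow> complex ^ 3 \<Rightarrow> bool" where
  "proj_eq u v \<longleftrightarrow> (\<exists>c. c \<noteq> 0 \<and> u = c *s v)"

definition on_line :: "complex ^ 3 \<Rightarrow> complex ^ 3 \<Rightarrow> bool" where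
  "on_line X l \<longleftrightarrow> scalar_product l X = 0"

definition conic_points :: "complex ^ 3 ^ 3 \<Rightarrow> (complex ^ 3) set" where
  "conic_points M = {X. X \<noteq> 0 \<and> scalar_product X (M *v X) = 0}"

definition conic_matrix :: "'a :: comm_ring_1 ^ 3 ^ 3 \<Rightarrow> bool" where
  "conic_matrix M \<longleftrightarrow> transpose M = M \<and> det M \<noteq> 0"

text \<open>The tangent line to the conic at its point \<open>T\<close> has the coordinate vector \<open>M *v T\<close>.\<close>

definition tangent_line :: "complex ^ 3 ^ 3 \<Rightarrow> complex ^ 3 \<Rightarrow> bool" where
  "tangent_line M l \<longleftrightarrow> (\<exists>T \<in> conic_points M. proj_eq l (M *v T))"

text \<open>
  The line \<open>l\<close> meets the conic exactly in \<open>X\<close> and \<open>Y\<close>. When \<open>l\<close> is tangent to the conic this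
  forces \<open>Y\<close> to be \<open>X\<close>, and otherwise it forces \<open>Y\<close> to be the point other than \<open>X\<close>: intersections
  are counted with multiplicity.
\<close>

definition line_meets_conic_in ::
    "complex ^ 3 ^ 3 \<Rightarrow> complex ^ 3 \<Rightarrow> complex ^ 3 \<Rightarrow> complex ^ 3 \<Rightarrow> bool" where
  "line_meets_conic_in M l X Y \<longleftrightarrow>
     {Z \<in> conic_points M. on_line Z l} = {Z. proj_eq Z X \<or> proj_eq Z Y}"

text \<open>
  The tangents to the conic through \<open>X\<close> are exactly \<open>l\<close> and \<open>m\<close>. They coincide precisely when \<open>X\<close>
  lies on the conic.
\<close>

definition tangents_through ::
    "complex ^ 3 ^ 3 \<Rightarrow> complex ^ 3 \<Rightarrow> complex ^ 3 \<Rightarrow> complex ^ 3 \<Rightarrow> bool" where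
  "tangents_through M X l m \<longleftrightarrow>
     {k. tangent_line M k \<and> on_line X k} = {k. proj_eq k l \<or> proj_eq k m}"

text \<open>\<open>l n\<close> is the tangent to \<open>A\<close> joining the points \<open>P n\<close> and \<open>P (Suc n)\<close> of \<open>B\<close>.\<close>

definition poncelet_trajectory ::
    "complex ^ 3 ^ 3 \<Rightarrow> complex ^ 3 ^ 3 \<Rightarrow> (nat \<Rightarrow> complex ^ 3) \<Rightarrow> (nat \<Rightarrow> complex ^ 3) \<Rightarrow> bool"
where
  "poncelet_trajectory A B P l \<longleftrightarrow>
     P 0 \<in> conic_points B \<and> tangent_line A (l 0) \<and> on_line (P 0) (l 0) \<and>
     (\<forall>n. line_meets_conic_in B (l n) (P n) (P (Suc n)) \<and>
          tangents_through A (P (Suc n)) (l n) (l (Suc n)))"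

definition poncelet_periodic :: "complex ^ 3 ^ 3 \<Rightarrow> complex ^ 3 ^ 3 \<Rightarrow> nat \<Rightarrow> bool" where
  "poncelet_periodic A B N \<longleftrightarrow>
     N > 0 \<and> (\<forall>P l. poncelet_trajectory A B P l \<longrightarrow> proj_eq (P N) (P 0) \<and> proj_eq (l N) (l 0))"

definition pell_abel_solvable :: "complex poly \<Rightarrow> bool" where
  "pell_abel_solvable R \<longleftrightarrow> (\<exists>P Q L. Q \<noteq> 0 \<and> P ^ 2 - R * Q ^ 2 = [:L ^ 2:])"

definition complexify :: "real ^ 3 ^ 3 \<Rightarrow> complex ^ 3 ^ 3" where
  "complexify M = (\<chi> i j. complex_of_real (M $ i $ j))"

end

theory Submission
  imports Defs "HOL-Computational_Algebra.Fundamental_Theorem_Algebra"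
begin

text \<open>
  Project the conic \<open>B\<close> from a transversal intersection point \<open>d\<close> of the two conics. In suitable
  coordinates the points of \<open>B\<close> and the tangents of \<open>A\<close> are parametrised by \<open>s\<close> and \<open>k\<close>, with \<open>s = \<infinity>\<close>
  at \<open>d\<close>, and a point \<open>s\<close> lies on a tangent \<open>k\<close> iff \<open>z = s\<close> is a root of \<open>((k z + \<epsilon>)\<^sup>2 - F(z)) / z\<close>, where
  \<open>\<epsilon>\<^sup>2 = F(0)\<close>: the line \<open>y = - (k z + \<epsilon>)\<close> meets the cubic \<open>y\<^sup>2 = F(z)\<close> over \<open>z = 0\<close> and over the two
  vertices joined by the tangent \<open>k\<close>. Multiplying these lines along \<open>n\<close> steps of a trajectory and
  cancelling the intermediate vertices gives polynomials with
  \<open>a\<^sup>2 - F b\<^sup>2 = c z\<^sup>n (z - s\<^sub>0) (z - s\<^sub>n)\<close>.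

  A periodic trajectory through \<open>d\<close> returns to \<open>d\<close>, and then this norm is a power of \<open>z\<close>; putting
  \<open>z = 1 / t\<close> solves the Pell--Abel equation. Conversely a Pell--Abel solution gives a function with
  norm \<open>L\<^sup>2 z\<^bsup>2m\<^esup>\<close>, whose quotient by the function of \<open>2 m\<close> steps has norm \<open>c (z - s\<^sub>0) (z - s\<^bsub>2m\<^esub>)\<close>.
  As \<open>F\<close> has odd degree, this forces \<open>s\<^bsub>2m\<^esub> = s\<^sub>0\<close>. If no intersection is transversal, the pencil contains
  a double line and the trajectory is a geometric or an arithmetic progression.
\<close>

section \<open>The norm form of a cubic\<close>

text \<open>Continuants. In \<open>chain_norm\<close> they give \<open>a n\<close> and
  \<open>b n\<close> such that, with \<open>y^2 = F\<close> and \<open>n > 0\<close>,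
  \<open>a n + b n y\<close> is the product of the \<open>l i + y\<close> for \<open>i < n\<close>
  divided by \<open>U 1 ... U (n - 1)\<close>. The recursion stays within polynomials, so this
  division never has to be carried out.\<close>

fun chain_poly ::
    "complex \<Rightarrow> (nat \<Rightarrow> complex) \<Rightarrow> complex poly \<Rightarrow> complex poly \<Rightarrow> nat \<Rightarrow> complex poly" where
  "chain_poly c k p q 0 = p"
| "chain_poly c k p q (Suc 0) = q"
| "chain_poly c k p q (Suc (Suc n)) =
     [:0, c:] * chain_poly c k p q n + [:k n + k (Suc n):] * chain_poly c k p q (Suc n)"

text \<open>\<open>k\<close> are the slopes of the lines and \<open>s\<close> the vertices; \<open>edge\<close> and \<open>vertex\<close> are Vieta's relations
  for the two vertices on a line and for the two lines through a vertex.\<close>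

lemma chain_norm:
  fixes f0 f1 f2 f3 eps :: complex and k s :: "nat \<Rightarrow> complex"
  assumes eps: "eps ^ 2 = f0" "eps \<noteq> 0" and f3: "f3 \<noteq> 0"
    and edge: "\<And>i. i < n \<Longrightarrow> f3 * (s i + s (Suc i)) = k i ^ 2 - f2"
      "\<And>i. i < n \<Longrightarrow> - f3 * s i * s (Suc i) = 2 * eps * k i - f1"
    and vertex: "\<And>i. Suc i < n \<Longrightarrow> s (Suc i) * (k i + k (Suc i)) = - 2 * eps"
    and n: "n > 0"
  shows "\<exists>a b. a ^ 2 - [:f0, f1, f2, f3:] * b ^ 2 =
           smult ((- f3) ^ n) ([:0, 1:] ^ n * [:- s 0, 1:] * [:- s n, 1:]) \<and>
         poly a 0 = eps * poly b 0 \<and> poly b 0 \<noteq> 0"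
proof -
  define F where "F = [:f0, f1, f2, f3:]"
  define X where "X = [:0, 1 :: complex:]"
  define U where "U = (\<lambda>i. [:- s i, 1:])"
  define l where "l = (\<lambda>i. [:eps, k i:])"
  define a where "a = chain_poly f3 k (U 0) (l 0)"
  define b where "b = chain_poly f3 k 0 1"
  have U0: "U i \<noteq> 0" for i by (simp add: U_def)
  \<comment> \<open>Coefficient by coefficient this is \<open>eps ^ 2 = f0\<close> and the two edge
    relations.\<close>
  have nl: "F = l i ^ 2 + smult f3 (X * U i * U (Suc i))" if "i < n" for i
    using edge[OF that] eps
    by (simp add: F_def l_def X_def U_def power2_eq_square algebra_simps)
  have ll: "l (Suc i) = [:k i + k (Suc i):] * U (Suc i) - l i" if "Suc i < n" for i
    using vertex[OF that] by (simp add: l_def U_def eq_diff_eq mult.commute)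
  have aS: "a (Suc (Suc i)) = smult f3 (X * a i) + [:k i + k (Suc i):] * a (Suc i)" for i
    by (simp add: a_def X_def)
  have bS: "b (Suc (Suc i)) = smult f3 (X * b i) + [:k i + k (Suc i):] * b (Suc i)" for i
    by (simp add: b_def X_def)
  \<comment> \<open>The two components of
    \<open>(a i + b i y) (l i + y) = U i (a (Suc i) + b (Suc i) y)\<close>, where
    \<open>y^2 = F\<close>.\<close>
  have step: "a i * l i + F * b i = U i * a (Suc i) \<and> a i + l i * b i = U i * b (Suc i)"
    if "i < n" for i
    using that
  proof (induction i)
    case 0
    then show ?case by (simp add: a_def b_def)
  next
    case (Suc i)
    define d where "d = [:k i + k (Suc i):]"
    from Suc have i: "i < n" and A: "a i * l i + F * b i = U i * a (Suc i)"
      and B: "a i + l i * b i = U i * b (Suc i)" by auto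
    have L: "l (Suc i) = d * U (Suc i) - l i" using ll[OF Suc.prems] by (simp add: d_def)
    have N: "F - l i ^ 2 = [:f3:] * X * U i * U (Suc i)" using nl[OF i] by simp
    \<comment> \<open>By \<open>L\<close>, \<open>l (Suc i) + y = d U (Suc i) + (y - l i)\<close>.
      Multiplication by \<open>y - l i\<close> undoes the previous step up to the factor
      \<open>F - l i ^ 2\<close>, which contains \<open>U i\<close>; facts \<open>1\<close> and
      \<open>2\<close> are the two components after cancelling.\<close>
    have "U i * (F * b (Suc i) - a (Suc i) * l i) = U i * ([:f3:] * X * U (Suc i) * a i)"
    proof -
      have "U i * (F * b (Suc i) - a (Suc i) * l i) = F * (U i * b (Suc i)) - (U i * a (Suc i)) * l i"
        by (simp add: algebra_simps)
      also have "\<dots> = a i * (F - l i ^ 2)"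
        unfolding A[symmetric] B[symmetric] by (simp add: algebra_simps power2_eq_square)
      finally show ?thesis unfolding N by (simp add: algebra_simps)
    qed
    then have 1: "F * b (Suc i) - a (Suc i) * l i = [:f3:] * X * U (Suc i) * a i"
      using U0 by (metis mult_left_cancel)
    have "U i * (a (Suc i) - l i * b (Suc i)) = U i * ([:f3:] * X * U (Suc i) * b i)"
    proof -
      have "U i * (a (Suc i) - l i * b (Suc i)) = (U i * a (Suc i)) - l i * (U i * b (Suc i))"
        by (simp add: algebra_simps)
      also have "\<dots> = b i * (F - l i ^ 2)"
        unfolding A[symmetric] B[symmetric] by (simp add: algebra_simps power2_eq_square)
      finally show ?thesis unfolding N by (simp add: algebra_simps)
    qed
    then have 2: "a (Suc i) - l i * b (Suc i) = [:f3:] * X * U (Suc i) * b i"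
      using U0 by (metis mult_left_cancel)
    have "a (Suc i) * l (Suc i) + F * b (Suc i) =
        d * U (Suc i) * a (Suc i) + (F * b (Suc i) - a (Suc i) * l i)"
      unfolding L by (simp add: algebra_simps)
    also have "\<dots> = U (Suc i) * a (Suc (Suc i))"
      unfolding 1 aS d_def[symmetric] by (simp add: algebra_simps)
    finally have 3: "a (Suc i) * l (Suc i) + F * b (Suc i) = U (Suc i) * a (Suc (Suc i))" .
    have "a (Suc i) + l (Suc i) * b (Suc i) =
        d * U (Suc i) * b (Suc i) + (a (Suc i) - l i * b (Suc i))"
      unfolding L by (simp add: algebra_simps)
    also have "\<dots> = U (Suc i) * b (Suc (Suc i))"
      unfolding 2 bS d_def[symmetric] by (simp add: algebra_simps)
    finally show ?case using 3 by blast
  qed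
  \<comment> \<open>The norm is multiplicative, and \<open>l i + y\<close> has norm
    \<open>- f3 X (U i) (U (Suc i))\<close>.\<close>
  have norm: "a i ^ 2 - F * b i ^ 2 = [:(- f3) ^ i:] * (X ^ i * U 0 * U i)" if "i \<le> n" for i
    using that
  proof (induction i)
    case 0
    then show ?case by (simp add: a_def b_def power2_eq_square)
  next
    case (Suc i)
    then have i: "i < n" by simp
    have "U i ^ 2 * (a (Suc i) ^ 2 - F * b (Suc i) ^ 2)
        = (U i * a (Suc i)) ^ 2 - F * (U i * b (Suc i)) ^ 2"
      by (simp add: algebra_simps power2_eq_square)
    also have "\<dots> = (a i * l i + F * b i) ^ 2 - F * (a i + l i * b i) ^ 2"
      using step[OF i] by simp
    also have "\<dots> = (a i ^ 2 - F * b i ^ 2) * (l i ^ 2 - F)"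
      by (simp add: algebra_simps power2_eq_square)
    also have "\<dots> = ([:(- f3) ^ i:] * (X ^ i * U 0 * U i)) * ([:- f3:] * (X * U i * U (Suc i)))"
      using Suc i nl[OF i] by simp
    also have "\<dots> = U i ^ 2 * ([:(- f3) ^ Suc i:] * (X ^ Suc i * U 0 * U (Suc i)))"
      by (simp add: algebra_simps power2_eq_square)
    finally show ?case using U0[of i] by (metis mult_left_cancel power_not_zero)
  qed
  \<comment> \<open>Over \<open>z = 0\<close> the function \<open>a + b y\<close> thus vanishes at
    \<open>y = - eps\<close> but not at \<open>y = eps\<close>. The factors
    \<open>k i + k (Suc i)\<close> are nonzero because \<open>eps\<close> is.\<close>
  have at0: "poly (a (Suc i)) 0 = eps * poly (b (Suc i)) 0 \<and> poly (b (Suc i)) 0 \<noteq> 0"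
    if "i < n" for i
    using that
  proof (induction i)
    case 0
    then show ?case by (simp add: a_def b_def l_def)
  next
    case (Suc i)
    have "k i + k (Suc i) \<noteq> 0" using vertex[OF Suc.prems] eps by auto
    then show ?case using Suc by (simp add: aS bS X_def)
  qed
  obtain m where m: "n = Suc m" using n gr0_implies_Suc by blast
  have "a n ^ 2 - F * b n ^ 2 = smult ((- f3) ^ n) (X ^ n * U 0 * U n)"
    using norm[of n] by simp
  with at0[of m] show ?thesis unfolding F_def X_def U_def m by blast
qed

section \<open>The norm equation and the Pell-Abel equation\<close>

text \<open>The Pell-Abel equation in the variable \<open>z = 1 / t\<close>. The exponent is even so
  that multiplication by \<open>(t^m)^2\<close> makes the right-hand side constant.\<close>

definition norm_solvable :: "complex poly \<Rightarrow> bool" where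
  "norm_solvable F \<longleftrightarrow> (\<exists>a b c m. c \<noteq> 0 \<and> b \<noteq> 0 \<and> a ^ 2 - F * b ^ 2 = smult c ([:0, 1:] ^ (2 * m)))"

text \<open>Squaring \<open>a + b y\<close> squares its norm and so doubles the exponent; the second
  component of the square is \<open>2 a b\<close>.\<close>

lemma norm_solvable_square:
  fixes F a b :: "complex poly"
  assumes "a ^ 2 - F * b ^ 2 = smult c ([:0, 1:] ^ m)" "c \<noteq> 0" "a * b \<noteq> 0"
  shows "norm_solvable F"
proof -
  have "(a ^ 2 + F * b ^ 2) ^ 2 - F * (2 * a * b) ^ 2 = (a ^ 2 - F * b ^ 2) ^ 2"
    by (simp add: power2_eq_square algebra_simps)
  also have "\<dots> = smult (c ^ 2) ([:0, 1:] ^ (2 * m))"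
    unfolding assms(1) by (simp add: smult_power power_mult[symmetric] mult.commute)
  finally show ?thesis using assms(2,3) unfolding norm_solvable_def
    by (intro exI[of _ "a ^ 2 + F * b ^ 2"] exI[of _ "2 * a * b"] exI[of _ "c ^ 2"] exI[of _ m]) auto
qed

text \<open>A square factor of \<open>F\<close> is absorbed into \<open>b\<close>. This serves
  coordinate changes, which multiply the characteristic polynomial by
  \<open>det S ^ 2\<close>.\<close>

lemma norm_solvable_smult:
  assumes "norm_solvable (smult (d ^ 2) F)" "d \<noteq> 0"
  shows "norm_solvable F"
proof -
  obtain a b c m where *: "c \<noteq> 0" "b \<noteq> 0" "a ^ 2 - smult (d ^ 2) F * b ^ 2 = smult c ([:0, 1:] ^ (2 * m))"
    using assms(1) unfolding norm_solvable_def by blast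
  then have "a ^ 2 - F * (smult d b) ^ 2 = smult c ([:0, 1:] ^ (2 * m))"
    by (simp add: smult_power[symmetric] power2_eq_square mult_ac)
  then show ?thesis unfolding norm_solvable_def using * assms(2)
    by (metis smult_eq_0_iff)
qed

text \<open>The degrees of the two terms have different parity, so their leading terms cannot
  cancel.\<close>

lemma norm_degrees:
  fixes F a b :: "complex poly"
  assumes F: "degree F = 3" and b: "b \<noteq> 0"
  shows "degree (a ^ 2 - F * b ^ 2) = max (2 * degree a) (2 * degree b + 3)"
    and "a ^ 2 - F * b ^ 2 \<noteq> 0"
proof -
  have F0: "F \<noteq> 0" using F by auto
  have 1: "degree (F * b ^ 2) = 2 * degree b + 3"
    using F b F0 by (simp add: degree_mult_eq degree_power_eq)
  have 2: "degree (a ^ 2) = 2 * degree a"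
    by (cases "a = 0") (simp_all add: degree_power_eq)
  have ne: "2 * degree a \<noteq> 2 * degree b + 3" by presburger
  show d: "degree (a ^ 2 - F * b ^ 2) = max (2 * degree a) (2 * degree b + 3)"
  proof (cases "2 * degree a < 2 * degree b + 3")
    case True
    then have "degree (a ^ 2 + - (F * b ^ 2)) = degree (- (F * b ^ 2))"
      by (intro degree_add_eq_right) (simp add: 1 2)
    then show ?thesis using True 1 by simp
  next
    case False
    then have "degree (a ^ 2 + - (F * b ^ 2)) = degree (a ^ 2)"
      using ne by (intro degree_add_eq_left) (simp add: 1 2)
    then show ?thesis using False 2 by simp
  qed
  then show "a ^ 2 - F * b ^ 2 \<noteq> 0" by auto
qed

lemma exists_reverse:
  fixes p :: "complex poly"
  assumes "degree p \<le> m"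
  obtains q where "\<And>t. t \<noteq> 0 \<Longrightarrow> poly q t = t ^ m * poly p (1 / t)"
    "coeff q 0 = coeff p m" "p \<noteq> 0 \<Longrightarrow> q \<noteq> 0"
proof
  \<comment> \<open>\<open>reflect_poly\<close> reverses with respect to the actual degree; the
    monomial pads the result up to \<open>m\<close>.\<close>
  let ?q = "monom 1 (m - degree p) * reflect_poly p"
  show "poly ?q t = t ^ m * poly p (1 / t)" if "t \<noteq> 0" for t
    using that assms by (simp add: poly_monom poly_reflect_poly_nz inverse_eq_divide
        power_add[symmetric] flip: mult.assoc)
  show "coeff ?q 0 = coeff p m"
    using assms by (cases "m = degree p") (auto simp: coeff_monom_mult coeff_eq_0)
  show "?q \<noteq> 0" if "p \<noteq> 0" using that by simp
qed

lemma poly_eqI_nonzero: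
  fixes p q :: "'a :: {idom, ring_char_0} poly"
  assumes "\<And>t. t \<noteq> 0 \<Longrightarrow> poly p t = poly q t"
  shows "p = q"
proof (rule ccontr)
  assume "p \<noteq> q"
  then have "finite {t. poly (p - q) t = 0}" by (intro poly_roots_finite) simp
  moreover have "UNIV - {0} \<subseteq> {t. poly (p - q) t = 0}" using assms by auto
  moreover have "infinite (UNIV - {0 :: 'a})" by (simp add: infinite_UNIV_char_0)
  ultimately show False using finite_subset by blast
qed

lemma norm_solvable_imp_pell_abel:
  assumes F: "degree F = 3" and R: "\<And>t. t \<noteq> 0 \<Longrightarrow> poly R t = t ^ 4 * poly F (1 / t)"
    and sol: "norm_solvable F"
  shows "pell_abel_solvable R"
proof -
  obtain a b c m where *: "c \<noteq> 0" "b \<noteq> 0" "a ^ 2 - F * b ^ 2 = smult c ([:0, 1:] ^ (2 * m))"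
    using sol unfolding norm_solvable_def by blast
  have "degree (a ^ 2 - F * b ^ 2) = 2 * m"
    unfolding *(3) using *(1) by (simp add: degree_power_eq)
  then have "2 * m = max (2 * degree a) (2 * degree b + 3)"
    using norm_degrees(1)[OF F *(2), of a] by simp
  \<comment> \<open>By parity, \<open>2 * degree b + 3 \<le> 2 * m\<close> sharpens to
    \<open>degree b + 2 \<le> m\<close>. So \<open>b\<close> can be reversed with exponent
    \<open>m - 2\<close>, the missing \<open>t^4\<close> in the square being supplied by
    \<open>R\<close>.\<close>
  then have da: "degree a \<le> m" and db: "degree b + 2 \<le> m" by linarith+
  obtain P where P: "\<And>t. t \<noteq> 0 \<Longrightarrow> poly P t = t ^ m * poly a (1 / t)"
    using exists_reverse[OF da] by blast
  have "degree b \<le> m - 2" using db by simp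
  then obtain Q where Q: "\<And>t. t \<noteq> 0 \<Longrightarrow> poly Q t = t ^ (m - 2) * poly b (1 / t)" "Q \<noteq> 0"
    using exists_reverse[of b "m - 2"] *(2) by auto
  have m: "t ^ m = t ^ 2 * t ^ (m - 2)" for t :: complex
    using db by (metis add_leD2 le_add_diff_inverse power_add)
  have "P ^ 2 - R * Q ^ 2 = [:csqrt c ^ 2:]"
  proof (rule poly_eqI_nonzero)
    fix t :: complex assume t: "t \<noteq> 0"
    have "poly (P ^ 2 - R * Q ^ 2) t = (t ^ m) ^ 2 * poly (a ^ 2 - F * b ^ 2) (1 / t)"
      using t by (simp add: P Q R m algebra_simps power2_eq_square eval_nat_numeral)
    also have "\<dots> = c"
      unfolding *(3) using t by (simp add: power_one_over power_mult[symmetric] mult.commute)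
    finally show "poly (P ^ 2 - R * Q ^ 2) t = poly [:csqrt c ^ 2:] t" by simp
  qed
  with Q(2) show ?thesis unfolding pell_abel_solvable_def by blast
qed

text \<open>Reversing \<open>P\<close> and \<open>Q\<close> inverts the substitution. The value of
  \<open>a\<close> at \<open>0\<close> is the leading coefficient of \<open>P\<close>, and
  \<open>L\<close> is nonzero because a norm with nonzero \<open>b\<close> does not vanish.\<close>

lemma pell_abel_imp_norm:
  assumes F: "degree F = 3" and R: "\<And>t. t \<noteq> 0 \<Longrightarrow> poly R t = t ^ 4 * poly F (1 / t)"
    "degree R = 4"
    and sol: "pell_abel_solvable R"
  obtains a b c m where "c \<noteq> 0" "m > 0" "a ^ 2 - F * b ^ 2 = smult c ([:0, 1:] ^ (2 * m))" "poly a 0 \<noteq> 0"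
proof -
  obtain P Q L where Q0: "Q \<noteq> 0" and PQ: "P ^ 2 - R * Q ^ 2 = [:L ^ 2:]"
    using sol unfolding pell_abel_solvable_def by blast
  have R0: "R \<noteq> 0" using R(2) by auto
  have dRQ: "degree (R * Q ^ 2) = 2 * (degree Q + 2)"
    using R(2) R0 Q0 by (simp add: degree_mult_eq degree_power_eq)
  have "P ^ 2 = R * Q ^ 2 + [:L ^ 2:]" using PQ by (simp add: algebra_simps)
  then have "degree (P ^ 2) = degree (R * Q ^ 2)"
    by (simp add: degree_add_eq_left dRQ)
  moreover have "degree (P ^ 2) = 2 * degree P"
    by (cases "P = 0") (simp_all add: degree_power_eq)
  ultimately have dP: "degree P = degree Q + 2" using dRQ by simp
  define m where "m = degree P"
  have P0: "P \<noteq> 0" using dP by auto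
  obtain a where a: "\<And>t. t \<noteq> 0 \<Longrightarrow> poly a t = t ^ m * poly P (1 / t)" "coeff a 0 = coeff P m"
    using exists_reverse[of P m] m_def by blast
  obtain b where b: "\<And>t. t \<noteq> 0 \<Longrightarrow> poly b t = t ^ (m - 2) * poly Q (1 / t)" "b \<noteq> 0"
    using exists_reverse[of Q "m - 2"] dP Q0 m_def by auto
  have m: "t ^ m = t ^ 2 * t ^ (m - 2)" for t :: complex
    using dP by (simp add: m_def flip: power_add)
  have FR: "poly F t = t ^ 4 * poly R (1 / t)" if "t \<noteq> 0" for t
    using R(1)[of "1 / t"] that by (simp add: power_one_over)
  have eq: "a ^ 2 - F * b ^ 2 = smult (L ^ 2) ([:0, 1:] ^ (2 * m))"
  proof (rule poly_eqI_nonzero)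
    fix t :: complex assume t: "t \<noteq> 0"
    have "poly (a ^ 2 - F * b ^ 2) t = (t ^ m) ^ 2 * poly (P ^ 2 - R * Q ^ 2) (1 / t)"
      using t by (simp add: a b FR m algebra_simps power2_eq_square eval_nat_numeral)
    also have "\<dots> = poly (smult (L ^ 2) ([:0, 1:] ^ (2 * m))) t"
      unfolding PQ by (simp add: power_mult[symmetric] mult.commute)
    finally show "poly (a ^ 2 - F * b ^ 2) t = poly (smult (L ^ 2) ([:0, 1:] ^ (2 * m))) t" .
  qed
  moreover have "L ^ 2 \<noteq> 0" using norm_degrees(2)[OF F b(2), of a] eq by auto
  moreover have "poly a 0 \<noteq> 0" using a(2) P0 by (simp add: m_def poly_0_coeff_0)
  moreover have "m > 0" using dP m_def by simp
  ultimately show ?thesis using that by blast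
qed

section \<open>Quotients of functions with the same zero over the origin\<close>

lemma power_X_dvd_cancel:
  fixes p q :: "complex poly"
  assumes "[:0, 1:] ^ m dvd p * q" "poly q 0 \<noteq> 0"
  shows "[:0, 1:] ^ m dvd p"
proof -
  show ?thesis
  proof (cases "p = 0")
    case False
    have q: "q \<noteq> 0" using assms(2) by auto
    have "m \<le> order 0 (p * q)"
      using assms(1) False q order_divides[of 0 m "p * q"] by simp
    also have "\<dots> = order 0 p" using False q assms(2) by (simp add: order_mult order_0I)
    finally show ?thesis using order_divides[of 0 m p] by simp
  qed simp
qed

text \<open>Both functions have their zeros of order \<open>m\<close> at the same point
  \<open>(0, - eps)\<close> of \<open>y^2 = F\<close>. Hence
  \<open>(a + b y) (c - d y) = \<alpha> + \<beta> y\<close> is divisible by \<open>z^m\<close>, and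
  the norm of the quotient is \<open>p q\<close>.\<close>

lemma norm_quotient:
  fixes F :: "complex poly"
  assumes ab: "a ^ 2 - F * b ^ 2 = [:0, 1:] ^ m * p" "poly a 0 = eps * poly b 0" "poly b 0 \<noteq> 0"
    and cd: "c ^ 2 - F * d ^ 2 = [:0, 1:] ^ m * q" "poly c 0 = eps * poly d 0" "poly d 0 \<noteq> 0"
    and eps: "eps \<noteq> 0"
  obtains u v where "u ^ 2 - F * v ^ 2 = p * q"
proof -
  define X where "X = [:0, 1 :: complex:]"
  define \<alpha> where "\<alpha> = a * c - F * b * d"
  define \<beta> where "\<beta> = b * c - a * d"
  have nm: "\<alpha> ^ 2 - F * \<beta> ^ 2 = X ^ (2 * m) * (p * q)"
  proof -
    have "\<alpha> ^ 2 - F * \<beta> ^ 2 = (a ^ 2 - F * b ^ 2) * (c ^ 2 - F * d ^ 2)"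
      unfolding \<alpha>_def \<beta>_def by (simp add: algebra_simps power2_eq_square)
    also have "\<dots> = X ^ (2 * m) * (p * q)"
      unfolding ab(1) cd(1) X_def mult_2 power_add by (simp only: mult_ac)
    finally show ?thesis .
  qed
  \<comment> \<open>The cofactor \<open>b c + a d\<close> takes at \<open>0\<close> the nonzero
    value \<open>2 eps b d\<close>, so the whole power of \<open>X\<close> divides
    \<open>\<beta>\<close>; the norm equation then yields the same for
    \<open>\<alpha>\<close>.\<close>
  have "\<beta> * (b * c + a * d) = b ^ 2 * (c ^ 2 - F * d ^ 2) - d ^ 2 * (a ^ 2 - F * b ^ 2)"
    unfolding \<beta>_def by (simp add: algebra_simps power2_eq_square)
  also have "\<dots> = X ^ m * (b ^ 2 * q - d ^ 2 * p)"
    unfolding ab(1) cd(1) X_def by (simp add: algebra_simps)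
  finally have "X ^ m dvd \<beta> * (b * c + a * d)" by simp
  moreover have "poly (b * c + a * d) 0 \<noteq> 0" using ab cd eps by simp
  ultimately have "X ^ m dvd \<beta>" unfolding X_def by (rule power_X_dvd_cancel)
  then obtain v where v: "\<beta> = X ^ m * v" by blast
  have "\<alpha> ^ 2 = (X ^ m) ^ 2 * (p * q + F * v ^ 2)"
    using nm unfolding v by (simp add: algebra_simps power_mult_distrib power_mult[symmetric])
  then have "(X ^ m) ^ 2 dvd \<alpha> ^ 2" by simp
  then have "X ^ (2 * m) dvd \<alpha> * \<alpha>" by (simp add: power2_eq_square mult_2 power_add)
  then have "X ^ m dvd \<alpha>"
    using order_divides[of 0 m \<alpha>] order_divides[of 0 "2 * m" "\<alpha> * \<alpha>"]
    by (cases "\<alpha> = 0") (auto simp: X_def order_mult)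
  then obtain u where u: "\<alpha> = X ^ m * u" by blast
  have "(X ^ m) ^ 2 * (u ^ 2 - F * v ^ 2) = (X ^ m) ^ 2 * (p * q)"
    using nm unfolding u v by (simp add: algebra_simps power_mult_distrib power_mult[symmetric])
  then have "u ^ 2 - F * v ^ 2 = p * q" by (simp add: X_def)
  then show ?thesis by (rule that)
qed

text \<open>A norm with nonzero \<open>v\<close> has degree at least three. So the quadratic is the
  square of \<open>u\<close> up to nothing else, and its roots coincide.\<close>

lemma norm_quadratic_roots_eq:
  fixes F u v :: "complex poly"
  assumes F: "degree F = 3" and eq: "u ^ 2 - F * v ^ 2 = smult c ([:- s, 1:] * [:- t, 1:])"
    and c: "c \<noteq> 0"
  shows "s = t"
proof -
  have "v = 0"
  proof (rule ccontr)
    assume "v \<noteq> 0"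
    from norm_degrees(1)[OF F this, of u] have "degree (u ^ 2 - F * v ^ 2) \<ge> 3" by simp
    moreover have "degree (smult c ([:- s, 1:] * [:- t, 1:])) = 2" using c by simp
    ultimately show False unfolding eq by simp
  qed
  then have eq': "u ^ 2 = smult c ([:- s, 1:] * [:- t, 1:])" using eq by simp
  have "poly (u ^ 2) s = 0" unfolding eq' by (simp add: algebra_simps)
  then have "poly u s = 0" by simp
  moreover have "poly (pderiv (u ^ 2)) s = c * (s - t)"
    unfolding eq' by (simp add: pderiv_mult pderiv_smult pderiv_pCons algebra_simps)
  ultimately show ?thesis using c by (simp add: pderiv_power algebra_simps power2_eq_square pderiv_mult)
qed

text \<open>The Pell--Abel unit and the chain have the same zero of order \<open>2 m\<close> above \<open>0\<close>, so their
  quotient is a function with norm of degree two; it must be constant.\<close>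

lemma chain_closes:
  fixes f0 f1 f2 f3 eps :: complex and k s :: "nat \<Rightarrow> complex"
  assumes eps: "eps ^ 2 = f0" "eps \<noteq> 0" and f3: "f3 \<noteq> 0"
    and edge: "\<And>i. i < 2 * m \<Longrightarrow> f3 * (s i + s (Suc i)) = k i ^ 2 - f2"
      "\<And>i. i < 2 * m \<Longrightarrow> - f3 * s i * s (Suc i) = 2 * eps * k i - f1"
    and vertex: "\<And>i. Suc i < 2 * m \<Longrightarrow> s (Suc i) * (k i + k (Suc i)) = - 2 * eps"
    and m: "m > 0"
    and sol: "a ^ 2 - [:f0, f1, f2, f3:] * b ^ 2 = smult c ([:0, 1:] ^ (2 * m))" "c \<noteq> 0" "poly a 0 \<noteq> 0"
  shows "s (2 * m) = s 0"
proof -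
  define F where "F = [:f0, f1, f2, f3:]"
  have F: "degree F = 3" using f3 by (simp add: F_def)
  have "\<exists>p q. p ^ 2 - F * q ^ 2 =
           smult ((- f3) ^ (2 * m)) ([:0, 1:] ^ (2 * m) * [:- s 0, 1:] * [:- s (2 * m), 1:]) \<and>
         poly p 0 = eps * poly q 0 \<and> poly q 0 \<noteq> 0"
    unfolding F_def by (rule chain_norm[OF eps f3]) (fact edge vertex | simp add: m)+
  then obtain p q where pq: "p ^ 2 - F * q ^ 2 =
           smult ((- f3) ^ (2 * m)) ([:0, 1:] ^ (2 * m) * [:- s 0, 1:] * [:- s (2 * m), 1:])"
         "poly p 0 = eps * poly q 0" "poly q 0 \<noteq> 0" by blast
  \<comment> \<open>At \<open>0\<close> the equation gives \<open>a = eps b\<close> or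
    \<open>a = - eps b\<close>. In the second case conjugation, \<open>b' = - b\<close>, moves the
    zero to the point where the chain has its own.\<close>
  have "(poly a 0) ^ 2 = (eps * poly b 0) ^ 2"
    using arg_cong[OF sol(1), of "\<lambda>p. poly p 0"] m eps(1) by (simp add: power_mult_distrib power_0_left)
  then have "poly a 0 = eps * poly b 0 \<or> poly a 0 = eps * poly (- b) 0"
    by (simp add: power2_eq_iff)
  then obtain b' where b': "a ^ 2 - F * b' ^ 2 = smult c ([:0, 1:] ^ (2 * m))" "poly a 0 = eps * poly b' 0"
    using sol(1) unfolding F_def by (metis power2_minus)
  from b' sol(3) have b'0: "poly b' 0 \<noteq> 0" by auto
  have 1: "p ^ 2 - F * q ^ 2 =
      [:0, 1:] ^ (2 * m) * smult ((- f3) ^ (2 * m)) ([:- s 0, 1:] * [:- s (2 * m), 1:])"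
    using pq(1) by (simp only: mult.assoc mult_smult_right)
  have 2: "a ^ 2 - F * b' ^ 2 = [:0, 1:] ^ (2 * m) * [:c:]" using b'(1) by simp
  obtain u v where "u ^ 2 - F * v ^ 2 =
      smult ((- f3) ^ (2 * m)) ([:- s 0, 1:] * [:- s (2 * m), 1:]) * [:c:]"
    using norm_quotient[OF 1 pq(2,3) 2 b'(2) b'0 eps(2)] by blast
  then have "u ^ 2 - F * v ^ 2 = smult (c * (- f3) ^ (2 * m)) ([:- s 0, 1:] * [:- s (2 * m), 1:])"
    by simp
  from norm_quadratic_roots_eq[OF F this] show ?thesis using sol(2) f3 by simp
qed

section \<open>Lines, conics and trajectories\<close>

declare transpose_matrix_vector [simp del]

section \<open>Bilinear algebra in three dimensions\<close>

lemma scalar_product_3: "scalar_product v w = v $ 1 * w $ 1 + v $ 2 * w $ 2 + v $ (3::3) * w $ 3"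
  by (simp add: scalar_product_def sum_3)

lemma matrix_vector_3: "(M *v x) $ i = M $ i $ 1 * x $ 1 + M $ i $ 2 * x $ 2 + M $ i $ (3::3) * x $ 3"
  by (simp add: matrix_vector_mult_def sum_3)

lemma vec_eq_3: "u = v \<longleftrightarrow> u $ 1 = v $ 1 \<and> u $ 2 = v $ 2 \<and> u $ (3::3) = v $ 3"
  by (simp add: vec_eq_iff forall_3)

lemma scalar_product_simps:
  fixes x y z :: "complex ^ 3"
  shows "scalar_product x (y + z) = scalar_product x y + scalar_product x z"
    "scalar_product (x + y) z = scalar_product x z + scalar_product y z"
    "scalar_product x (y - z) = scalar_product x y - scalar_product x z"
    "scalar_product x (c *s y) = c * scalar_product x y"
    "scalar_product (c *s x) y = c * scalar_product x y"
    "scalar_product x 0 = 0" "scalar_product 0 x = 0"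
  by (simp_all add: scalar_product_3 algebra_simps)

lemma scalar_product_commute: "scalar_product x y = scalar_product y (x :: complex ^ 3)"
  by (simp add: scalar_product_3 mult.commute)

lemma scalar_product_transpose:
  fixes x y :: "complex ^ 3"
  shows "scalar_product x (M *v y) = scalar_product (transpose M *v x) y"
  by (simp add: scalar_product_3 matrix_vector_3 transpose_def algebra_simps)

lemma scalar_product_symmetric:
  assumes "transpose M = M"
  shows "scalar_product x (M *v y) = scalar_product (y :: complex ^ 3) (M *v (x :: complex ^ 3))"
  by (simp add: scalar_product_transpose[of x] assms scalar_product_commute[of y])

lemma exists_scalar_product_eq_1:
  fixes v :: "complex ^ 3"
  assumes "v \<noteq> 0"
  shows "\<exists>w. scalar_product w v = 1"
proof -
  obtain i where i: "v $ i \<noteq> 0" using assms by (auto simp: vec_eq_iff)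
  have "scalar_product (axis i (1 / v $ i)) v = 1"
    using i by (simp add: scalar_product_def axis_def if_distrib[of "\<lambda>x. x * _"] cong: if_cong)
  then show ?thesis ..
qed

text \<open>The library's cross product is real only.\<close>

definition crs :: "complex ^ 3 \<Rightarrow> complex ^ 3 \<Rightarrow> complex ^ 3" where
  "crs u v = vector [u $ 2 * v $ 3 - u $ 3 * v $ 2, u $ 3 * v $ 1 - u $ 1 * v $ 3,
     u $ 1 * v $ 2 - u $ 2 * v $ 1]"

lemma crs_component:
  "crs u v $ 1 = u $ 2 * v $ 3 - u $ 3 * v $ 2"
  "crs u v $ 2 = u $ 3 * v $ 1 - u $ 1 * v $ 3"
  "crs u v $ 3 = u $ 1 * v $ 2 - u $ 2 * v $ 1"
  by (simp_all add: crs_def)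

lemma crs_orthogonal: "scalar_product u (crs u v) = 0" "scalar_product v (crs u v) = 0"
  by (simp_all add: scalar_product_3 crs_component algebra_simps)

lemma scalar_product_crs_rotate: "scalar_product u (crs v w) = scalar_product v (crs w u)"
  by (simp add: scalar_product_3 crs_component algebra_simps)

lemma crs_smult: "crs (c *s u) v = c *s crs u v" "crs u (c *s v) = c *s crs u v"
  by (simp_all add: vec_eq_3 crs_component algebra_simps)

lemma crs_self: "crs u u = 0"
  by (simp add: vec_eq_3 crs_component algebra_simps)

lemma crs_lagrange:
  "scalar_product (crs u v) (crs x y) =
     scalar_product u x * scalar_product v y - scalar_product u y * scalar_product v x"
  by (simp add: scalar_product_3 crs_component algebra_simps)

lemma crs_swap: "crs u v = (- 1) *s crs v u"
  by (simp add: vec_eq_3 crs_component)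

text \<open>Cramer's rule for the coordinates of \<open>z\<close> with respect to
  \<open>x, w, e\<close>, with the determinant cleared.\<close>

lemma crs_cramer:
  "scalar_product (crs x w) e *s z =
     scalar_product z (crs w e) *s x + scalar_product z (crs e x) *s w + scalar_product z (crs x w) *s e"
  by (simp add: vec_eq_3 scalar_product_3 crs_component algebra_simps)

text \<open>The expansion of \<open>u\<close> in the basis dual to \<open>e, x, w\<close>, with the
  determinant cleared.\<close>

lemma crs_triple:
  "scalar_product e (crs x w) *s u = scalar_product u e *s crs x w
     + scalar_product u w *s crs e x - scalar_product u x *s crs e w"
  by (simp add: vec_eq_3 scalar_product_3 crs_component algebra_simps)

lemma crs_parallel:
  assumes "crs x w \<noteq> 0" "scalar_product u x = 0" "scalar_product u w = 0"
  obtains c where "u = c *s crs x w"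
proof -
  obtain e where e: "scalar_product e (crs x w) = 1" using exists_scalar_product_eq_1[OF assms(1)] by blast
  show ?thesis using crs_triple[of e x w u] e assms(2,3) by (intro that[of "scalar_product u e"]) simp
qed

lemma crs_span:
  assumes "crs x w \<noteq> 0" "scalar_product z (crs x w) = 0"
  obtains a b where "z = a *s x + b *s w"
proof -
  obtain e where e: "scalar_product e (crs x w) = 1" using exists_scalar_product_eq_1[OF assms(1)] by blast
  show ?thesis using crs_cramer[of x w e z] e assms(2)
    by (intro that[of "scalar_product z (crs w e)" "scalar_product z (crs e x)"])
       (simp add: scalar_product_commute[of _ e])
qed

lemma crs_eq_0:
  assumes "crs x w = 0" "x \<noteq> 0"
  obtains c where "w = c *s x"
proof -
  obtain e where e: "scalar_product e x = 1" using exists_scalar_product_eq_1[OF assms(2)] by blast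
  have "scalar_product e x *s w - scalar_product e w *s x = crs e (crs w x)"
    by (simp add: vec_eq_3 scalar_product_3 crs_component algebra_simps)
  also have "\<dots> = 0" using assms(1) crs_swap[of w x] by (simp add: vec_eq_3 crs_component)
  finally show ?thesis using e by (intro that[of "scalar_product e w"]) simp
qed

section \<open>Intersections of a line with a conic\<close>

lemma proj_eq_refl [simp]: "proj_eq u u"
  unfolding proj_eq_def by (rule exI[of _ 1]) simp

lemma proj_eq_sym: "proj_eq u v \<Longrightarrow> proj_eq v u"
  unfolding proj_eq_def
proof (elim exE conjE)
  fix c assume "c \<noteq> 0" "u = c *s v"
  then show "\<exists>c. c \<noteq> 0 \<and> v = c *s u" by (intro exI[of _ "1 / c"]) simp
qed

lemma proj_eq_trans: "proj_eq u v \<Longrightarrow> proj_eq v w \<Longrightarrow> proj_eq u w"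
  unfolding proj_eq_def by (metis mult_eq_0_iff vector_smult_assoc)

lemma proj_eq_crs:
  assumes "crs x w = 0" "x \<noteq> 0" "w \<noteq> 0"
  shows "proj_eq w x"
  using crs_eq_0[OF assms(1,2)] assms(3) unfolding proj_eq_def by (metis vector_smult_lzero)

lemma on_line_cong: "proj_eq X Y \<Longrightarrow> proj_eq l m \<Longrightarrow> on_line X l \<longleftrightarrow> on_line Y m"
  unfolding proj_eq_def on_line_def by (auto simp: scalar_product_simps)

lemma conic_points_cong: "proj_eq X Y \<Longrightarrow> X \<in> conic_points M \<longleftrightarrow> Y \<in> conic_points M"
  unfolding proj_eq_def conic_points_def by (auto simp: scalar_product_simps vector_scalar_commute)

lemma conic_matrix_ker:
  fixes M :: "complex ^ 3 ^ 3"
  assumes "conic_matrix M" "M *v x = 0"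
  shows "x = 0"
  using assms by (metis conic_matrix_def invertible_det_nz invertible_left_inverse
      matrix_left_invertible_ker)

lemma line_meets_conic_iff:
  "line_meets_conic_in M l X Y \<longleftrightarrow>
     (\<forall>Z. Z \<in> conic_points M \<and> on_line Z l \<longleftrightarrow> proj_eq Z X \<or> proj_eq Z Y)"
  unfolding line_meets_conic_in_def set_eq_iff by simp

lemma tangents_through_iff:
  "tangents_through M X l m \<longleftrightarrow>
     (\<forall>k. tangent_line M k \<and> on_line X k \<longleftrightarrow> proj_eq k l \<or> proj_eq k m)"
  unfolding tangents_through_def set_eq_iff by simp

text \<open>If \<open>l\<close> is the polar \<open>u\<close> of \<open>X\<close>, it is the tangent
  there and \<open>X\<close> counts twice. Otherwise the quadratic form restricted to
  \<open>l\<close> splits into a factor vanishing at \<open>X\<close> and a second linear factor,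
  whose zero is \<open>Y\<close>.\<close>

lemma line_meets_conic_exists:
  assumes M: "conic_matrix M" and l: "l \<noteq> 0" and X: "X \<in> conic_points M" "on_line X l"
  shows "\<exists>Y. line_meets_conic_in M l X Y"
proof -
  define u where "u = M *v X"
  have X0: "X \<noteq> 0" and XX: "scalar_product X u = 0" using X(1) by (auto simp: conic_points_def u_def)
  have lX: "scalar_product l X = 0" using X(2) by (simp add: on_line_def)
  have u0: "u \<noteq> 0" using conic_matrix_ker[OF M] X0 by (auto simp: u_def)
  have sym: "scalar_product x (M *v y) = scalar_product y (M *v x)" for x y
    using M scalar_product_symmetric by (auto simp: conic_matrix_def)
  have conic: "Z \<in> conic_points M \<and> on_line Z l" if "proj_eq Z X" for Z
    using conic_points_cong[OF that] on_line_cong[OF that proj_eq_refl] X by blast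
  show ?thesis
  proof (cases "crs l u = 0")
    case True
    then obtain c where c: "u = c *s l" using crs_eq_0 l by blast
    have "line_meets_conic_in M l X X"
      unfolding line_meets_conic_iff
    proof (intro allI iffI; (rule ccontr)?)
      fix Z assume "Z \<in> conic_points M \<and> on_line Z l" "\<not> (proj_eq Z X \<or> proj_eq Z X)"
      then have Z: "Z \<in> conic_points M" "on_line Z l" "\<not> proj_eq Z X" by auto
      then have Z0: "Z \<noteq> 0" and ZZ: "scalar_product (M *v Z) Z = 0"
        by (auto simp: conic_points_def scalar_product_commute)
      have uZ: "scalar_product u Z = 0" using Z(2) by (simp add: c scalar_product_simps on_line_def)
      then have ZX: "scalar_product (M *v Z) X = 0" by (metis sym scalar_product_commute u_def)
      have uX: "scalar_product u X = 0" using XX scalar_product_commute by metis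
      have g: "crs X Z \<noteq> 0" using proj_eq_crs X0 Z0 Z(3) by blast
      obtain a where a: "u = a *s crs X Z" using crs_parallel[OF g uX uZ] .
      obtain b where b: "M *v Z = b *s crs X Z" using crs_parallel[OF g ZX ZZ] .
      \<comment> \<open>A second common point \<open>Z\<close> has the same polar line as
        \<open>X\<close>; injectivity of \<open>M\<close> then makes \<open>X\<close> and
        \<open>Z\<close> proportional.\<close>
      have "M *v (b *s X - a *s Z) = 0"
        using a b by (simp add: matrix_vector_mult_diff_distrib vector_scalar_commute u_def mult.commute)
      then have "b *s X = a *s Z" using conic_matrix_ker[OF M] by fastforce
      then have "a *s crs X Z = 0" by (metis crs_self crs_smult(2) vector_smult_rzero)
      then show False using a u0 by simp
    next
      fix Z assume "proj_eq Z X \<or> proj_eq Z X" "\<not> (Z \<in> conic_points M \<and> on_line Z l)"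
      with conic show False by blast
    qed
    then show ?thesis ..
  next
    case False
    then obtain e where e: "scalar_product e (crs l u) = 1" using exists_scalar_product_eq_1 by blast
    \<comment> \<open>A further point of \<open>l\<close>, scaled so that the polar of
      \<open>X\<close> takes the value \<open>1\<close> on it.\<close>
    define W where "W = crs e l"
    have lW: "scalar_product l W = 0" by (simp add: W_def crs_orthogonal)
    have uW: "scalar_product u W = 1" using e scalar_product_crs_rotate[of u e l] by (simp add: W_def)
    define w where "w = scalar_product W (M *v W)"
    have XMW: "scalar_product X (M *v W) = 1" using uW sym u_def by (metis scalar_product_commute)
    have WMX: "scalar_product W (M *v X) = 1" using XMW sym by metis
    have XMX: "scalar_product X (M *v X) = 0" using XX u_def by simp
    have form: "scalar_product (a *s X + b *s W) (M *v (a *s X + b *s W)) = b * (2 * a + b * w)" for a b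
      by (simp add: scalar_product_simps vector_scalar_commute matrix_vector_right_distrib XMW WMX XMX
          w_def algebra_simps)
    \<comment> \<open>The pair \<open>(w, - 2)\<close> is the zero of the factor
      \<open>2 a + b w\<close> in \<open>form\<close>.\<close>
    define Y where "Y = w *s X + (- 2) *s W"
    have "scalar_product u Y = - 2"
      using uW XX by (simp add: Y_def scalar_product_simps scalar_product_commute)
    then have Y0: "Y \<noteq> 0" by (auto simp: scalar_product_simps)
    have Yc: "Y \<in> conic_points M" using Y0 form[of w "- 2"] by (simp add: conic_points_def Y_def)
    have Yl: "on_line Y l" using lX lW by (simp add: on_line_def Y_def scalar_product_simps)
    have g: "crs X W \<noteq> 0"
    proof
      assume "crs X W = 0"
      then obtain c where "W = c *s X" using crs_eq_0 X0 by blast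
      then show False using uW XX by (simp add: scalar_product_simps scalar_product_commute)
    qed
    obtain c where c: "l = c *s crs X W" using crs_parallel[OF g lX lW] .
    have "line_meets_conic_in M l X Y"
      unfolding line_meets_conic_iff
    proof (intro allI iffI; (rule ccontr)?)
      fix Z assume "Z \<in> conic_points M \<and> on_line Z l" and ne: "\<not> (proj_eq Z X \<or> proj_eq Z Y)"
      then have Z: "Z \<in> conic_points M" "on_line Z l" "\<not> proj_eq Z Y" by auto
      have "scalar_product Z (crs X W) = 0"
        using Z(2) l c by (auto simp: on_line_def scalar_product_simps scalar_product_commute)
      then obtain a b where ab: "Z = a *s X + b *s W" using crs_span[OF g] by blast
      have "b * (2 * a + b * w) = 0" using Z(1) form by (simp add: conic_points_def ab)
      moreover have "b = 0"
      proof (rule ccontr)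
        assume b: "b \<noteq> 0"
        then have "2 * a + b * w = 0" using calculation by simp
        then have "a = (- b / 2) * w" by (simp add: field_simps eq_neg_iff_add_eq_0)
        then have "Z = (- b / 2) *s Y" by (simp add: ab Y_def vector_add_ldistrib)
        then show False using Z(3) b unfolding proj_eq_def by (metis divide_eq_0_iff neg_equal_0_iff_equal zero_neq_numeral)
      qed
      moreover have "Z \<noteq> 0" using Z(1) by (simp add: conic_points_def)
      ultimately have "proj_eq Z X" unfolding proj_eq_def by (intro exI[of _ a]) (auto simp: ab)
      with ne show False by blast
    next
      fix Z assume "proj_eq Z X \<or> proj_eq Z Y" "\<not> (Z \<in> conic_points M \<and> on_line Z l)"
      then show False
        using conic conic_points_cong on_line_cong[OF _ proj_eq_refl] Yc Yl by blast
    qed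
    then show ?thesis ..
  qed
qed

lemma line_meets_conic_two:
  assumes M: "conic_matrix M" and l: "l \<noteq> 0" and X: "X \<in> conic_points M" "on_line X l"
    and Y: "Y \<in> conic_points M" "on_line Y l" and XY: "\<not> proj_eq X Y"
  shows "line_meets_conic_in M l X Y"
proof -
  obtain Y' where Y': "line_meets_conic_in M l X Y'" using line_meets_conic_exists[OF M l X] ..
  then have "proj_eq Y Y'" using Y XY proj_eq_sym unfolding line_meets_conic_iff by blast
  then show ?thesis using Y' proj_eq_sym proj_eq_trans unfolding line_meets_conic_iff by blast
qed

text \<open>Equal unordered pairs with equal first members have equal second members, a double
  intersection included. This makes the point step of a trajectory deterministic.\<close>

lemma line_meets_conic_cong:
  assumes "line_meets_conic_in M l X Y" "line_meets_conic_in M l' X' Y'" "proj_eq l l'" "proj_eq X X'"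
  shows "proj_eq Y Y'"
proof -
  have "proj_eq Z X \<or> proj_eq Z Y \<longleftrightarrow> proj_eq Z X' \<or> proj_eq Z Y'" for Z
    using assms(1,2) on_line_cong[OF proj_eq_refl assms(3)] unfolding line_meets_conic_iff by metis
  then have "proj_eq Y X' \<or> proj_eq Y Y'" "proj_eq Y' X \<or> proj_eq Y' Y" by (metis proj_eq_refl)+
  then show ?thesis using assms(4) proj_eq_sym proj_eq_trans by metis
qed

lemma line_meets_conic_commute: "line_meets_conic_in M l X Y \<longleftrightarrow> line_meets_conic_in M l Y X"
  unfolding line_meets_conic_in_def by (simp add: disj_commute)

lemma line_meets_conic_points:
  assumes "line_meets_conic_in M l X Y"
  shows "X \<in> conic_points M" "on_line X l" "Y \<in> conic_points M" "on_line Y l"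
  using assms unfolding line_meets_conic_iff by (metis proj_eq_refl)+

section \<open>Duality: tangents through a point\<close>

text \<open>The tangents of a conic are the points of the conic with the inverse matrix. Tangents
  through \<open>X\<close> thus become intersections of that conic with the line \<open>X\<close>,
  and the results on intersections carry over.\<close>

lemma dual_conic:
  assumes M: "conic_matrix (M :: complex ^ 3 ^ 3)"
  obtains D where "conic_matrix D" "\<And>k. k \<in> conic_points D \<longleftrightarrow> tangent_line M k"
    "\<And>X l m. tangents_through M X l m \<longleftrightarrow> line_meets_conic_in D X l m"
proof -
  have "invertible M" using M by (simp add: conic_matrix_def invertible_det_nz)
  then obtain D where D: "M ** D = mat 1" "D ** M = mat 1" by (auto simp: invertible_def)
  have "transpose D ** M = mat 1"
    using D(1) M by (metis conic_matrix_def matrix_transpose_mul transpose_mat)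
  then have "transpose D = D" using D by (metis matrix_mul_assoc matrix_mul_lid matrix_mul_rid)
  moreover have "det D \<noteq> 0" using D(1) by (metis det_I det_mul mult_zero_right zero_neq_one)
  ultimately have DM: "conic_matrix D" by (simp add: conic_matrix_def)
  have inv: "M *v (D *v x) = x" "D *v (M *v x) = x" for x
    using D by (simp_all add: matrix_vector_mul_assoc)
  have tan: "k \<in> conic_points D \<longleftrightarrow> tangent_line M k" for k
  proof
    assume k: "k \<in> conic_points D"
    then have "D *v k \<noteq> 0" using inv by (metis (mono_tags) conic_points_def matrix_vector_mult_0_right mem_Collect_eq)
    then have "D *v k \<in> conic_points M" using k by (simp add: conic_points_def inv scalar_product_commute)
    then show "tangent_line M k" unfolding tangent_line_def
      by (metis inv(1) proj_eq_refl)
  next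
    assume "tangent_line M k"
    then obtain T c where T: "T \<in> conic_points M" "c \<noteq> 0" "k = c *s (M *v T)"
      by (auto simp: tangent_line_def proj_eq_def)
    then have "M *v T \<noteq> 0" using conic_matrix_ker[OF M] by (auto simp: conic_points_def)
    then show "k \<in> conic_points D"
      using T by (auto simp: conic_points_def vector_scalar_commute inv scalar_product_simps scalar_product_commute)
  qed
  show ?thesis
    using that[OF DM tan] tan
    unfolding tangents_through_def line_meets_conic_in_def on_line_def
    by (simp add: scalar_product_commute)
qed

lemma tangents_through_cong:
  assumes "conic_matrix M" "tangents_through M X l m" "tangents_through M X' l' m'" "proj_eq X X'"
    "proj_eq l l'"
  shows "proj_eq m m'"
proof -
  obtain D where D: "\<And>X l m. tangents_through M X l m \<longleftrightarrow> line_meets_conic_in D X l m"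
    using dual_conic[OF assms(1)] by metis
  show ?thesis
    by (rule line_meets_conic_cong[OF assms(2,3)[unfolded D] assms(4,5)])
qed

lemma tangents_through_commute: "tangents_through M X l m \<longleftrightarrow> tangents_through M X m l"
  unfolding tangents_through_def by (simp add: disj_commute)

lemma tangents_through_lines:
  assumes "tangents_through M X l m"
  shows "tangent_line M l" "on_line X l" "tangent_line M m" "on_line X m"
  using assms unfolding tangents_through_iff by (metis proj_eq_refl)+

lemma tangents_through_exists:
  assumes "conic_matrix M" "X \<noteq> 0" "tangent_line M l" "on_line X l"
  shows "\<exists>m. tangents_through M X l m"
proof -
  obtain D where D: "conic_matrix D" "\<And>k. k \<in> conic_points D \<longleftrightarrow> tangent_line M k"
    "\<And>X l m. tangents_through M X l m \<longleftrightarrow> line_meets_conic_in D X l m"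
    using dual_conic[OF assms(1)] by metis
  show ?thesis using line_meets_conic_exists[of D X l] D assms
    by (metis on_line_def scalar_product_commute)
qed

lemma tangents_through_two:
  assumes "conic_matrix M" "X \<noteq> 0" "tangent_line M l" "on_line X l" "tangent_line M m" "on_line X m"
    "\<not> proj_eq l m"
  shows "tangents_through M X l m"
proof -
  obtain D where D: "conic_matrix D" "\<And>k. k \<in> conic_points D \<longleftrightarrow> tangent_line M k"
    "\<And>X l m. tangents_through M X l m \<longleftrightarrow> line_meets_conic_in D X l m"
    using dual_conic[OF assms(1)] by metis
  show ?thesis using line_meets_conic_two[of D X l m] D assms
    by (metis on_line_def scalar_product_commute)
qed

lemma tangent_line_nonzero: "conic_matrix M \<Longrightarrow> tangent_line M l \<Longrightarrow> l \<noteq> 0"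
  using dual_conic[of M] by (metis (mono_tags) conic_points_def mem_Collect_eq)

section \<open>Trajectories and their returns\<close>

text \<open>Periodicity is a statement about all trajectories; drawing a conclusion from it requires
  one with a prescribed start. Dependent choice builds it, with \<open>I\<close> as the invariant
  that lets every step continue.\<close>

lemma poncelet_trajectory_exists:
  assumes A: "conic_matrix A" and B: "conic_matrix B"
    and P0: "P0 \<in> conic_points B" "tangent_line A l0" "on_line P0 l0"
  shows "\<exists>P l. poncelet_trajectory A B P l \<and> P 0 = P0 \<and> l 0 = l0"
proof -
  define I where "I = (\<lambda>(X, l). X \<in> conic_points B \<and> tangent_line A l \<and> on_line X l)"
  have "\<exists>f. \<forall>n. (I (f n) \<and> (n = 0 \<longrightarrow> f n = (P0, l0))) \<and>
      (line_meets_conic_in B (snd (f n)) (fst (f n)) (fst (f (Suc n))) \<and>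
       tangents_through A (fst (f (Suc n))) (snd (f n)) (snd (f (Suc n))))"
  proof (rule dependent_nat_choice)
    show "\<exists>x. I x \<and> (0 = (0::nat) \<longrightarrow> x = (P0, l0))" using P0 by (auto simp: I_def)
  next
    fix x and n :: nat assume x: "I x \<and> (n = 0 \<longrightarrow> x = (P0, l0))"
    obtain X l where xl: "x = (X, l)" by (cases x)
    have X: "X \<in> conic_points B" "tangent_line A l" "on_line X l" using x by (auto simp: I_def xl)
    obtain Y where Y: "line_meets_conic_in B l X Y"
      using line_meets_conic_exists[OF B tangent_line_nonzero[OF A X(2)] X(1,3)] ..
    note Y' = line_meets_conic_points[OF Y]
    have "Y \<noteq> 0" using Y' by (simp add: conic_points_def)
    then obtain m where m: "tangents_through A Y l m"
      using tangents_through_exists[OF A _ X(2) Y'(4)] by blast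
    show "\<exists>y. (I y \<and> (Suc n = 0 \<longrightarrow> y = (P0, l0))) \<and>
      (line_meets_conic_in B (snd x) (fst x) (fst y) \<and> tangents_through A (fst y) (snd x) (snd y))"
      using Y m Y' tangents_through_lines[OF m] by (intro exI[of _ "(Y, m)"]) (auto simp: I_def xl)
  qed
  then obtain f where f: "\<And>n. I (f n)" "f 0 = (P0, l0)"
     "\<And>n. line_meets_conic_in B (snd (f n)) (fst (f n)) (fst (f (Suc n)))"
     "\<And>n. tangents_through A (fst (f (Suc n))) (snd (f n)) (snd (f (Suc n)))" by blast
  show ?thesis
    using f P0 by (intro exI[of _ "\<lambda>n. fst (f n)"] exI[of _ "\<lambda>n. snd (f n)"])
      (auto simp: poncelet_trajectory_def)
qed

context
  fixes A B :: "complex ^ 3 ^ 3" and P l :: "nat \<Rightarrow> complex ^ 3"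
  assumes A: "conic_matrix A" and traj: "poncelet_trajectory A B P l"
begin

lemma trajectory_step:
  "line_meets_conic_in B (l n) (P n) (P (Suc n))" "tangents_through A (P (Suc n)) (l n) (l (Suc n))"
  using traj by (auto simp: poncelet_trajectory_def)

lemma trajectory_forward:
  assumes "proj_eq (P m) (P n)" "proj_eq (l m) (l n)"
  shows "proj_eq (P (m + i)) (P (n + i)) \<and> proj_eq (l (m + i)) (l (n + i))"
proof (induction i)
  case (Suc i)
  have "proj_eq (P (Suc (m + i))) (P (Suc (n + i)))"
    using line_meets_conic_cong[OF trajectory_step(1) trajectory_step(1)] Suc by blast
  then show ?case using tangents_through_cong[OF A trajectory_step(2) trajectory_step(2)] Suc by simp
qed (use assms in simp)

text \<open>Both step relations are symmetric in the pair they determine, so a trajectory can also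
  be run backwards.\<close>

lemma trajectory_backward:
  assumes "proj_eq (P (m + i)) (P (n + i))" "proj_eq (l (m + i)) (l (n + i))"
  shows "proj_eq (P m) (P n) \<and> proj_eq (l m) (l n)"
  using assms
proof (induction i)
  case (Suc i)
  have "proj_eq (l (m + i)) (l (n + i))"
    using tangents_through_cong[OF A, of "P (Suc (m + i))" "l (Suc (m + i))" "l (m + i)"
        "P (Suc (n + i))" "l (Suc (n + i))" "l (n + i)"] trajectory_step(2) Suc.prems
    by (simp add: tangents_through_commute)
  moreover have "proj_eq (P (m + i)) (P (n + i))"
    using line_meets_conic_cong[of B "l (m + i)" "P (Suc (m + i))" "P (m + i)"
        "l (n + i)" "P (Suc (n + i))" "P (n + i)"] trajectory_step(1) Suc.prems calculation
    by (simp add: line_meets_conic_commute)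
  ultimately show ?case using Suc.IH by blast
qed simp

text \<open>A return observed at any index \<open>j\<close> is carried back to index
  \<open>0\<close> and then iterated.\<close>

lemma trajectory_periodic:
  assumes "proj_eq (P (j + r)) (P j)" "proj_eq (l (j + r)) (l j)" "r dvd N"
  shows "proj_eq (P N) (P 0) \<and> proj_eq (l N) (l 0)"
proof -
  have 0: "proj_eq (P r) (P 0) \<and> proj_eq (l r) (l 0)"
    using trajectory_backward[of r j 0] assms by (simp add: add.commute)
  have "proj_eq (P (r * q)) (P 0) \<and> proj_eq (l (r * q)) (l 0)" for q
  proof (induction q)
    case (Suc q)
    have "proj_eq (P (r + r * q)) (P (0 + r * q)) \<and> proj_eq (l (r + r * q)) (l (0 + r * q))"
      using trajectory_forward 0 by blast
    then show ?case using Suc proj_eq_trans by (simp only: mult_Suc_right add_0) blast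
  qed simp
  then show ?thesis using assms(3) by (auto elim: dvdE)
qed

end

section \<open>Linear changes of coordinates\<close>

text \<open>The pullback of the conic \<open>M\<close> along \<open>S\<close>: points are carried to
  \<open>M\<close> by \<open>S\<close>, lines by the transposed inverse.\<close>

definition congr :: "complex ^ 3 ^ 3 \<Rightarrow> complex ^ 3 ^ 3 \<Rightarrow> complex ^ 3 ^ 3" where
  "congr S M = transpose S ** M ** S"

lemma congr_conic_matrix: "conic_matrix M \<Longrightarrow> det S \<noteq> 0 \<Longrightarrow> conic_matrix (congr S M)"
  by (simp add: conic_matrix_def congr_def det_mul matrix_transpose_mul matrix_mul_assoc)

lemma scalar_product_congr: "scalar_product x (congr S M *v y) = scalar_product (S *v x) (M *v (S *v y))"
  by (simp add: congr_def matrix_vector_mul_assoc[symmetric] scalar_product_transpose[of x])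

lemma congr_component: "congr S M $ i $ j = scalar_product (column i S) (M *v column j S)"
proof -
  have 1: "S *v axis k 1 = column k S" for k
    by (simp add: vec_eq_iff matrix_vector_mult_def axis_def column_def if_distrib cong: if_cong)
  have 2: "scalar_product (axis i 1) v = v $ i" for v :: "complex ^ 3"
    by (simp add: scalar_product_def axis_def if_distrib[of "\<lambda>x. x * _"] cong: if_cong)
  have 3: "(M *v axis k 1) $ i = M $ i $ k" for M :: "complex ^ 3 ^ 3" and k
    by (simp add: matrix_vector_mult_def axis_def if_distrib cong: if_cong)
  have "congr S M $ i $ j = scalar_product (axis i 1) (congr S M *v axis j 1)"
    by (simp add: 2 3)
  then show ?thesis by (simp add: scalar_product_congr 1)
qed

lemma det_congr_pencil:
  "det (congr S A - mat z ** congr S B) = det S ^ 2 * det (A - mat z ** B)"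
proof -
  have m: "(mat z ** M) $ i $ j = z * M $ i $ j" for M :: "complex ^ 3 ^ 3" and i j
    by (simp add: matrix_matrix_mult_def mat_def if_distrib[of "\<lambda>x. x * _"] cong: if_cong)
  have "congr S A - mat z ** congr S B = congr S (A - mat z ** B)"
    by (simp add: vec_eq_iff congr_component m scalar_product_3 matrix_vector_3 algebra_simps)
  then show ?thesis by (simp add: congr_def det_mul power2_eq_square)
qed

context
  fixes S T :: "complex ^ 3 ^ 3"
  assumes ST: "S ** T = mat 1" "T ** S = mat 1"
begin

lemma inverse_simps: "S *v (T *v x) = x" "T *v (S *v x) = x"
    "transpose S *v (transpose T *v x) = x" "transpose T *v (transpose S *v x) = x"
  using ST by (simp_all add: matrix_vector_mul_assoc flip: matrix_transpose_mul)

lemma proj_eq_mult: "proj_eq (S *v X) (S *v Y) \<longleftrightarrow> proj_eq X Y"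
    "proj_eq (transpose T *v X) (transpose T *v Y) \<longleftrightarrow> proj_eq X Y"
  unfolding proj_eq_def by (metis inverse_simps vector_scalar_commute)+

lemma congr_conic_points: "X \<in> conic_points (congr S M) \<longleftrightarrow> S *v X \<in> conic_points M"
  unfolding conic_points_def scalar_product_congr mem_Collect_eq by (metis inverse_simps(2) matrix_vector_mult_0_right)

lemma congr_on_line: "on_line (S *v X) (transpose T *v l) \<longleftrightarrow> on_line X l"
  unfolding on_line_def by (metis inverse_simps(2) scalar_product_transpose)

lemma congr_tangent_line: "tangent_line (congr S M) l \<longleftrightarrow> tangent_line M (transpose T *v l)"
proof -
  have "proj_eq l (congr S M *v X) \<longleftrightarrow> proj_eq (transpose T *v l) (M *v (S *v X))" for X
    unfolding congr_def by (metis inverse_simps(4) matrix_vector_mul_assoc proj_eq_mult(2))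
  then show ?thesis unfolding tangent_line_def Bex_def congr_conic_points by (metis inverse_simps(1))
qed

lemma congr_line_meets:
  assumes "line_meets_conic_in (congr S M) l X Y"
  shows "line_meets_conic_in M (transpose T *v l) (S *v X) (S *v Y)"
proof -
  have "Z \<in> conic_points M \<and> on_line Z (transpose T *v l) \<longleftrightarrow> proj_eq Z (S *v X) \<or> proj_eq Z (S *v Y)" for Z
  proof -
    have "T *v Z \<in> conic_points (congr S M) \<and> on_line (T *v Z) l \<longleftrightarrow> proj_eq (T *v Z) X \<or> proj_eq (T *v Z) Y"
      using assms unfolding line_meets_conic_iff by blast
    then show ?thesis
      by (metis congr_conic_points congr_on_line inverse_simps(1) proj_eq_mult(1))
  qed
  then show ?thesis unfolding line_meets_conic_iff by blast
qed

lemma congr_tangents_through: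
  assumes "tangents_through (congr S M) X l m"
  shows "tangents_through M (S *v X) (transpose T *v l) (transpose T *v m)"
proof -
  have "tangent_line M k \<and> on_line (S *v X) k \<longleftrightarrow> proj_eq k (transpose T *v l) \<or> proj_eq k (transpose T *v m)" for k
  proof -
    let ?k = "transpose S *v k"
    have "tangent_line (congr S M) ?k \<and> on_line X ?k \<longleftrightarrow> proj_eq ?k l \<or> proj_eq ?k m"
      using assms unfolding tangents_through_iff by blast
    then show ?thesis
      by (metis congr_tangent_line congr_on_line inverse_simps(4) proj_eq_mult(2))
  qed
  then show ?thesis unfolding tangents_through_iff by blast
qed

lemma congr_poncelet_periodic:
  assumes "poncelet_periodic A B N"
  shows "poncelet_periodic (congr S A) (congr S B) N"
  unfolding poncelet_periodic_def
proof (intro conjI allI impI)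
  show "N > 0" using assms by (simp add: poncelet_periodic_def)
next
  fix P l assume t: "poncelet_trajectory (congr S A) (congr S B) P l"
  have "poncelet_trajectory A B (\<lambda>n. S *v P n) (\<lambda>n. transpose T *v l n)"
    using t unfolding poncelet_trajectory_def
    by (simp add: congr_line_meets congr_tangents_through congr_conic_points congr_tangent_line
        congr_on_line)
  then have "proj_eq (S *v P N) (S *v P 0) \<and> proj_eq (transpose T *v l N) (transpose T *v l 0)"
    using assms unfolding poncelet_periodic_def by blast
  then show "proj_eq (P N) (P 0)" "proj_eq (l N) (l 0)" by (simp_all add: proj_eq_mult)
qed

end

section \<open>Pencils with a transversal intersection\<close>

text \<open>A pencil with a transversal intersection point, in coordinates where that point is
  \<open>(0, 0, 1)\<close>; the coefficients of the characteristic polynomial can then be read off.\<close>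

definition nf_A :: "'a :: field \<Rightarrow> 'a \<Rightarrow> 'a \<Rightarrow> 'a ^ 3 ^ 3" where
  "nf_A f0 f1 f2 = vector [vector [- f0, - f1 / 2, 0], vector [- f1 / 2, - f2, 1], vector [0, 1, 0]]"

definition nf_B :: "'a :: field \<Rightarrow> 'a ^ 3 ^ 3" where
  "nf_B f3 = vector [vector [0, 0, 1], vector [0, f3, 0], vector [1, 0, 0]]"

text \<open>A homogeneous parametrisation of \<open>nf_B f3\<close>; the parameter
  \<open>(0, 1)\<close> belongs to the base point \<open>(0, 0, 1)\<close>.\<close>

definition nf_point :: "complex \<Rightarrow> complex \<Rightarrow> complex \<Rightarrow> complex ^ 3" where
  "nf_point f3 r s = vector [r ^ 2, r * s, - f3 * s ^ 2 / 2]"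

text \<open>The tangents of \<open>nf_A\<close> for \<open>eps ^ 2 = f0\<close>, parametrised
  homogeneously; \<open>(1, 0)\<close> belongs to the tangent at the base point.\<close>

definition nf_tangent :: "complex \<Rightarrow> complex \<Rightarrow> complex \<Rightarrow> complex \<Rightarrow> complex \<Rightarrow> complex ^ 3" where
  "nf_tangent f1 f2 eps k m = vector [2 * eps * k * m - f1 * m ^ 2, k ^ 2 - f2 * m ^ 2, 2 * m ^ 2]"

lemma pencil_component: "(A - mat z ** B) $ i $ j = A $ i $ j - z * B $ i $ (j :: 3)"
  for A B :: "'a :: field ^ 3 ^ 3"
  by (simp add: matrix_matrix_mult_def mat_def if_distrib[of "\<lambda>x. x * _"] cong: if_cong)

lemma det_nf_pencil:
  fixes f0 f1 f2 f3 z :: "'a :: field_char_0"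
  shows "det (nf_A f0 f1 f2 - mat z ** nf_B f3) = f0 + f1 * z + f2 * z ^ 2 + f3 * z ^ 3"
  by (simp only: det_3 pencil_component)
     (simp add: nf_A_def nf_B_def field_simps power2_eq_square power3_eq_cube)

lemma nf_conic_matrix:
  fixes f0 f1 f2 f3 :: "'a :: field_char_0"
  shows "f0 \<noteq> 0 \<Longrightarrow> conic_matrix (nf_A f0 f1 f2)" "f3 \<noteq> 0 \<Longrightarrow> conic_matrix (nf_B f3)"
  unfolding conic_matrix_def
  by (auto simp: det_3 nf_A_def nf_B_def transpose_def vec_eq_iff forall_3)

lemma nf_conic_points_B:
  "X \<in> conic_points (nf_B f3) \<longleftrightarrow> X \<noteq> 0 \<and> 2 * X $ 1 * X $ 3 + f3 * X $ 2 ^ 2 = 0"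
  by (simp add: conic_points_def scalar_product_3 matrix_vector_3 nf_B_def power2_eq_square algebra_simps)

lemma nf_conic_points_A:
  "X \<in> conic_points (nf_A f0 f1 f2) \<longleftrightarrow>
     X \<noteq> 0 \<and> 2 * X $ 2 * X $ 3 = f0 * X $ 1 ^ 2 + f1 * X $ 1 * X $ 2 + f2 * X $ 2 ^ 2"
proof -
  have "scalar_product X (nf_A f0 f1 f2 *v X) =
     2 * X $ 2 * X $ 3 - (f0 * X $ 1 ^ 2 + f1 * X $ 1 * X $ 2 + f2 * X $ 2 ^ 2)"
    by (simp add: scalar_product_3 matrix_vector_3 nf_A_def power2_eq_square algebra_simps)
  then show ?thesis by (simp add: conic_points_def)
qed

section \<open>The incidence correspondence in normal form\<close>

locale normal_form =
  fixes f0 f1 f2 f3 eps :: complex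
  assumes eps: "eps ^ 2 = f0" "eps \<noteq> 0" and f3: "f3 \<noteq> 0"
begin

abbreviation "A \<equiv> nf_A f0 f1 f2"
abbreviation "B \<equiv> nf_B f3"
abbreviation "pt \<equiv> nf_point f3"
abbreviation "tgl \<equiv> nf_tangent f1 f2 eps"

lemma pt_component: "pt r s $ 1 = r ^ 2" "pt r s $ 2 = r * s" "pt r s $ 3 = - f3 * s ^ 2 / 2"
  by (simp_all add: nf_point_def)

lemma tgl_component: "tgl k m $ 1 = 2 * eps * k * m - f1 * m ^ 2" "tgl k m $ 2 = k ^ 2 - f2 * m ^ 2"
    "tgl k m $ 3 = 2 * m ^ 2"
  by (simp_all add: nf_tangent_def)

lemma pt_nonzero: "pt 1 s \<noteq> 0" "pt 0 1 \<noteq> 0"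
  using f3 by (auto simp: vec_eq_3 pt_component)

lemma nf_A_conic: "conic_matrix A" by (rule nf_conic_matrix(1)) (use eps in auto)

lemma pt_on_conic: "pt 1 s \<in> conic_points B" "pt 0 1 \<in> conic_points B"
  using pt_nonzero by (auto simp: nf_conic_points_B pt_component power2_eq_square)

lemma conic_point_cases:
  assumes "X \<in> conic_points B"
  obtains s where "proj_eq X (pt 1 s)" | "proj_eq X (pt 0 1)"
proof -
  have X: "X \<noteq> 0" "2 * X $ 1 * X $ 3 + f3 * X $ 2 ^ 2 = 0"
    using assms by (simp_all add: nf_conic_points_B)
  show ?thesis
  proof (cases "X $ 1 = 0")
    case True
    then have 2: "X $ 2 = 0" using X(2) f3 by simp
    then have "X $ 3 \<noteq> 0" using X(1) True by (auto simp: vec_eq_3)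
    moreover have "X = (- 2 * X $ 3 / f3) *s pt 0 1"
      using True 2 f3 by (simp add: vec_eq_3 pt_component)
    ultimately have "proj_eq X (pt 0 1)" using f3 unfolding proj_eq_def
      by (intro exI[of _ "- 2 * X $ 3 / f3"]) simp
    then show ?thesis by (rule that(2))
  next
    case False
    have "X $ 3 = - (f3 * X $ 2 ^ 2) / (2 * X $ 1)"
      using X(2) False by (simp add: field_simps eq_neg_iff_add_eq_0)
    then have "X = X $ 1 *s pt 1 (X $ 2 / X $ 1)"
      using False by (simp add: vec_eq_3 pt_component field_simps power2_eq_square)
    then have "proj_eq X (pt 1 (X $ 2 / X $ 1))" using False unfolding proj_eq_def by blast
    then show ?thesis by (rule that(1))
  qed
qed

lemma proj_eq_pt: "proj_eq (pt 1 s) (pt 1 t) \<longleftrightarrow> s = t" "\<not> proj_eq (pt 1 s) (pt 0 1)"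
    "\<not> proj_eq (pt 0 1) (pt 1 s)"
  unfolding proj_eq_def using f3 by (auto simp: vec_eq_3 pt_component intro!: exI[of _ 1])

lemma proj_eq_tgl: "proj_eq (tgl k 1) (tgl h 1) \<longleftrightarrow> k = h" "\<not> proj_eq (tgl k 1) (tgl 1 0)"
    "\<not> proj_eq (tgl 1 0) (tgl k 1)"
  unfolding proj_eq_def using eps by (auto simp: vec_eq_3 tgl_component intro!: exI[of _ 1])

lemma tgl_tangent: "tangent_line A (tgl k 1)" "tangent_line A (tgl 1 0)"
proof -
  \<comment> \<open>The point of contact, found by solving \<open>A *v T = tgl k 1\<close>.\<close>
  let ?T = "vector [- 2 * k / eps, 2, k ^ 2 + f2 - f1 * k / eps] :: complex ^ 3"
  have "?T \<in> conic_points A"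
    using eps by (auto simp: nf_conic_points_A vec_eq_3 field_simps power2_eq_square)
  moreover have "tgl k 1 = A *v ?T"
    using eps by (auto simp: vec_eq_3 tgl_component matrix_vector_3 nf_A_def field_simps power2_eq_square)
  ultimately show "tangent_line A (tgl k 1)" unfolding tangent_line_def by (metis proj_eq_refl)
  let ?T = "vector [0, 0, 1] :: complex ^ 3"
  have "?T \<in> conic_points A" by (simp add: nf_conic_points_A vec_eq_3)
  moreover have "tgl 1 0 = A *v ?T" by (simp add: vec_eq_3 tgl_component matrix_vector_3 nf_A_def)
  ultimately show "tangent_line A (tgl 1 0)" unfolding tangent_line_def by (metis proj_eq_refl)
qed

lemma tangent_line_cases:
  assumes "tangent_line A l"
  obtains k where "proj_eq l (tgl k 1)" | "proj_eq l (tgl 1 0)"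
proof -
  obtain T where T: "T \<in> conic_points A" "proj_eq l (A *v T)"
    using assms by (auto simp: tangent_line_def)
  have T0: "T \<noteq> 0" and T1: "2 * T $ 2 * T $ 3 = f0 * T $ 1 ^ 2 + f1 * T $ 1 * T $ 2 + f2 * T $ 2 ^ 2"
    using T(1) by (simp_all add: nf_conic_points_A)
  show ?thesis
  proof (cases "T $ 2 = 0")
    case True
    then have 1: "T $ 1 = 0" using T1 eps by auto
    then have "T $ 3 \<noteq> 0" using T0 True by (auto simp: vec_eq_3)
    moreover have "A *v T = T $ 3 *s tgl 1 0"
      using True 1 by (simp add: vec_eq_3 tgl_component matrix_vector_3 nf_A_def)
    ultimately have "proj_eq (A *v T) (tgl 1 0)" unfolding proj_eq_def by blast
    then show ?thesis using that(2) T(2) proj_eq_trans by blast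
  next
    case False
    \<comment> \<open>The contact point of \<open>tgl k 1\<close> has its first two coordinates in
      the ratio \<open>- k : eps\<close>.\<close>
    define k where "k = - eps * T $ 1 / T $ 2"
    have k: "k * T $ 2 = - eps * T $ 1" using False by (simp add: k_def)
    have "(k * T $ 2) ^ 2 = f0 * T $ 1 ^ 2" unfolding k using eps by (simp add: power_mult_distrib)
    then have "T $ 2 * (2 * (T $ 3 - f1 * T $ 1 / 2 - f2 * T $ 2)) = T $ 2 * (T $ 2 * (k ^ 2 - f2))"
      using T1 by (simp add: algebra_simps power2_eq_square)
    then have "2 * (T $ 3 - f1 * T $ 1 / 2 - f2 * T $ 2) = T $ 2 * (k ^ 2 - f2)" using False by simp
    then have 2: "T $ 3 - f1 * T $ 1 / 2 - f2 * T $ 2 = T $ 2 / 2 * (k ^ 2 - f2)"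
      by (simp add: field_simps)
    have "eps * (k * T $ 2) = - f0 * T $ 1" unfolding k using eps(1) by (simp add: power2_eq_square)
    then have 1: "- f0 * T $ 1 - f1 / 2 * T $ 2 = T $ 2 / 2 * (2 * eps * k - f1)"
      by (simp add: algebra_simps)
    have "A *v T = (T $ 2 / 2) *s tgl k 1"
      using 1 2 by (simp add: vec_eq_3 tgl_component matrix_vector_3 nf_A_def algebra_simps)
    then have "proj_eq (A *v T) (tgl k 1)" unfolding proj_eq_def using False
      by (intro exI[of _ "T $ 2 / 2"]) simp
    then show ?thesis using that(1) T(2) proj_eq_trans by blast
  qed
qed

text \<open>The polynomial is \<open>((k s + eps)^2 - F(s)) / s\<close>. It is quadratic in
  \<open>s\<close> with leading coefficient \<open>- f3\<close> and quadratic in \<open>k\<close>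
  with leading coefficient \<open>s\<close>; Vieta in \<open>s\<close> gives the edge relations and
  Vieta in \<open>k\<close> the vertex relation.\<close>

lemma incidence: "on_line (pt 1 s) (tgl k 1) \<longleftrightarrow> 2 * eps * k - f1 + (k ^ 2 - f2) * s - f3 * s ^ 2 = 0"
  "\<not> on_line (pt 0 1) (tgl k 1)" "on_line (pt 0 1) (tgl 1 0)" "on_line (pt 1 s) (tgl 1 0) \<longleftrightarrow> s = 0"
  using f3 by (auto simp: on_line_def scalar_product_3 pt_component tgl_component)

lemma finite_point:
  assumes "X \<in> conic_points B" "on_line X l" "proj_eq l (tgl k 1)"
  obtains s where "proj_eq X (pt 1 s)"
  using conic_point_cases[OF assms(1)] on_line_cong[OF _ assms(3)] assms(2) incidence(2) by metis

lemma line_meets_pt: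
  assumes "line_meets_conic_in B l X Y" "proj_eq l (tgl k m)"
  shows "on_line (pt 1 t) (tgl k m) \<longleftrightarrow> proj_eq (pt 1 t) X \<or> proj_eq (pt 1 t) Y"
    "on_line (pt 0 1) (tgl k m) \<longleftrightarrow> proj_eq (pt 0 1) X \<or> proj_eq (pt 0 1) Y"
  using assms(1) pt_on_conic on_line_cong[OF proj_eq_refl assms(2)]
  unfolding line_meets_conic_iff by blast+

lemma tangents_through_tgl:
  assumes "tangents_through A X l m" "proj_eq X (pt r s)"
  shows "on_line (pt r s) (tgl k 1) \<longleftrightarrow> proj_eq (tgl k 1) l \<or> proj_eq (tgl k 1) m"
    "on_line (pt r s) (tgl 1 0) \<longleftrightarrow> proj_eq (tgl 1 0) l \<or> proj_eq (tgl 1 0) m"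
  using assms(1) tgl_tangent on_line_cong[OF assms(2) proj_eq_refl]
  unfolding tangents_through_iff by blast+

lemma edge_relation:
  assumes "line_meets_conic_in B l X Y" "proj_eq X (pt 1 s)" "proj_eq Y (pt 1 t)" "proj_eq l (tgl k 1)"
  shows "f3 * (s + t) = k ^ 2 - f2" "- f3 * s * t = 2 * eps * k - f1"
proof -
  have roots: "2 * eps * k - f1 + (k ^ 2 - f2) * x - f3 * x ^ 2 = 0 \<longleftrightarrow> x = s \<or> x = t" for x
  proof -
    have "proj_eq (pt 1 x) X \<longleftrightarrow> proj_eq (pt 1 x) (pt 1 s)" "proj_eq (pt 1 x) Y \<longleftrightarrow> proj_eq (pt 1 x) (pt 1 t)"
      using assms(2,3) proj_eq_sym proj_eq_trans by blast+
    then show ?thesis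
      using line_meets_pt(1)[OF assms(1,4), of x] unfolding incidence proj_eq_pt(1) by simp
  qed
  \<comment> \<open>The second root prescribed by Vieta. The incidences only determine the set of
    roots; comparing \<open>{s, u}\<close> with \<open>{s, t}\<close> gives \<open>u = t\<close>
    also for a double root.\<close>
  define u where "u = (k ^ 2 - f2) / f3 - s"
  have fu: "f3 * (s + u) = k ^ 2 - f2" using f3 by (simp add: u_def field_simps)
  have s: "2 * eps * k - f1 + (k ^ 2 - f2) * s - f3 * s ^ 2 = 0" using roots by blast
  have P: "2 * eps * k - f1 = - f3 * s * u"
    using s unfolding fu[symmetric] by (simp add: algebra_simps power2_eq_square)
  have fac: "2 * eps * k - f1 + (k ^ 2 - f2) * x - f3 * x ^ 2 = - f3 * (x - s) * (x - u)" for x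
    unfolding P fu[symmetric] by (simp add: algebra_simps power2_eq_square)
  have "x = s \<or> x = u \<longleftrightarrow> x = s \<or> x = t" for x
    using roots[of x] f3 unfolding fac by simp
  then have "u = t" by metis
  then show "f3 * (s + t) = k ^ 2 - f2" "- f3 * s * t = 2 * eps * k - f1" using fu P by auto
qed

lemma vertex_relation:
  assumes "tangents_through A X l m" "proj_eq X (pt 1 s)" "proj_eq l (tgl k 1)" "proj_eq m (tgl h 1)"
  shows "s * (k + h) = - 2 * eps"
proof -
  have roots: "2 * eps * x - f1 + (x ^ 2 - f2) * s - f3 * s ^ 2 = 0 \<longleftrightarrow> x = k \<or> x = h" for x
  proof -
    have "proj_eq (tgl x 1) l \<longleftrightarrow> proj_eq (tgl x 1) (tgl k 1)" "proj_eq (tgl x 1) m \<longleftrightarrow> proj_eq (tgl x 1) (tgl h 1)"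
      using assms(3,4) proj_eq_sym proj_eq_trans by blast+
    then show ?thesis
      using tangents_through_tgl(1)[OF assms(1,2), of x] unfolding incidence proj_eq_tgl(1) by simp
  qed
  \<comment> \<open>For \<open>s = 0\<close> the tangent \<open>tgl 1 0\<close> would be a tangent
    through \<open>X\<close> as well; so the incidence polynomial is truly quadratic in
    \<open>k\<close>.\<close>
  have "\<not> on_line (pt 1 s) (tgl 1 0)"
    using tangents_through_tgl(2)[OF assms(1,2)] assms(3,4) proj_eq_tgl(3) proj_eq_trans by blast
  then have s0: "s \<noteq> 0" by (simp add: incidence)
  define u where "u = - 2 * eps / s - k"
  have su: "s * (k + u) = - 2 * eps" using s0 by (simp add: u_def field_simps)
  have k: "2 * eps * k - f1 + (k ^ 2 - f2) * s - f3 * s ^ 2 = 0" using roots by blast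
  have e: "2 * eps = - s * (k + u)" using su by simp
  have "2 * eps * x - f1 + (x ^ 2 - f2) * s - f3 * s ^ 2 =
      (2 * eps * k - f1 + (k ^ 2 - f2) * s - f3 * s ^ 2) + (2 * eps * (x - k) + (x ^ 2 - k ^ 2) * s)" for x
    by (simp add: algebra_simps)
  also have "\<dots> x = s * (x - k) * (x - u)" for x
    unfolding k unfolding e by (simp add: algebra_simps power2_eq_square)
  finally have "x = k \<or> x = u \<longleftrightarrow> x = k \<or> x = h" for x using roots[of x] s0 by simp
  then have "u = h" by metis
  then show ?thesis using su by simp
qed

lemma special_line:
  assumes "line_meets_conic_in B l X Y" "proj_eq l (tgl 1 0)"
  shows "proj_eq X (pt 0 1) \<and> proj_eq Y (pt 1 0) \<or> proj_eq X (pt 1 0) \<and> proj_eq Y (pt 0 1)"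
proof -
  have "proj_eq (pt 1 0) X \<or> proj_eq (pt 1 0) Y" "proj_eq (pt 0 1) X \<or> proj_eq (pt 0 1) Y"
    using line_meets_pt[OF assms] incidence(3,4) by blast+
  then show ?thesis using proj_eq_pt proj_eq_sym proj_eq_trans by metis
qed

text \<open>The base point lies on \<open>A\<close>, so only one tangent of \<open>A\<close> passes
  through it: a trajectory arriving there turns back along the same line.\<close>

lemma base_point_tangent:
  assumes "tangents_through A X l m" "proj_eq X (pt 0 1)"
  shows "proj_eq m (tgl 1 0)"
proof -
  have "on_line X m" "tangent_line A m" using tangents_through_lines[OF assms(1)] by auto
  then show ?thesis
    using tangent_line_cases[of m] on_line_cong[OF assms(2)] incidence(2) by metis
qed

text \<open>At \<open>s = 0\<close> the incidence is linear in \<open>k\<close>, with root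
  \<open>f1 / (2 * eps)\<close>; the other tangent there has \<open>k\<close> at infinity.\<close>

lemma opposite_point_tangent:
  assumes "tangents_through A X l m" "proj_eq X (pt 1 0)" "proj_eq l (tgl 1 0)"
  shows "proj_eq m (tgl (f1 / (2 * eps)) 1)"
proof -
  have "on_line (pt 1 0) (tgl (f1 / (2 * eps)) 1)" using eps by (simp add: incidence)
  then have "proj_eq (tgl (f1 / (2 * eps)) 1) l \<or> proj_eq (tgl (f1 / (2 * eps)) 1) m"
    using tangents_through_tgl(1)[OF assms(1,2)] by blast
  then show ?thesis using proj_eq_tgl proj_eq_sym proj_eq_trans assms(3) by metis
qed

end

section \<open>Trajectories in the coordinates s and k\<close>

context normal_form
begin

context
  fixes P l :: "nat \<Rightarrow> complex ^ 3"
  assumes traj: "poncelet_trajectory A B P l"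
begin

text \<open>Only the tangent at the base point is excluded. The coordinates chosen below are
  meaningful on affine lines and at their two end points.\<close>

definition affine_line where "affine_line n \<longleftrightarrow> \<not> proj_eq (l n) (tgl 1 0)"
definition line_coord where "line_coord n = (SOME k. proj_eq (l n) (tgl k 1))"
definition point_coord where "point_coord n = (SOME s. proj_eq (P n) (pt 1 s))"

lemmas step = trajectory_step[OF nf_A_conic traj]

lemma tangent: "tangent_line A (l n)"
  using tangents_through_lines(1)[OF step(2)] .

lemma line_coord: "affine_line n \<Longrightarrow> proj_eq (l n) (tgl (line_coord n) 1)"
  using tangent_line_cases[OF tangent] unfolding affine_line_def line_coord_def by (metis someI)

lemma point_coord:
  assumes "affine_line n"
  shows "proj_eq (P n) (pt 1 (point_coord n))" "proj_eq (P (Suc n)) (pt 1 (point_coord (Suc n)))"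
proof -
  note on = line_meets_conic_points[OF step(1)[of n]]
  show "proj_eq (P n) (pt 1 (point_coord n))"
    using finite_point[OF on(1,2) line_coord[OF assms]] unfolding point_coord_def by (metis someI)
  show "proj_eq (P (Suc n)) (pt 1 (point_coord (Suc n)))"
    using finite_point[OF on(3,4) line_coord[OF assms]] unfolding point_coord_def by (metis someI)
qed

lemma edge:
  assumes "affine_line n"
  shows "f3 * (point_coord n + point_coord (Suc n)) = line_coord n ^ 2 - f2" "- f3 * point_coord n * point_coord (Suc n) = 2 * eps * line_coord n - f1"
  using edge_relation[OF step(1) point_coord[OF assms] line_coord[OF assms]] by auto

lemma vertex:
  assumes "affine_line n" "affine_line (Suc n)"
  shows "point_coord (Suc n) * (line_coord n + line_coord (Suc n)) = - 2 * eps"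
  using vertex_relation[OF step(2) point_coord(2)[OF assms(1)] line_coord[OF assms(1)] line_coord[OF assms(2)]] .

lemma departure:
  assumes "proj_eq (P j) (pt 0 1)" "proj_eq (l j) (tgl 1 0)"
  shows "affine_line (Suc j)" "point_coord (Suc j) = 0"
proof -
  have "\<not> proj_eq (P j) (pt 1 0)" using assms(1) proj_eq_pt proj_eq_sym proj_eq_trans by metis
  then have Z: "proj_eq (P (Suc j)) (pt 1 0)" using special_line[OF step(1) assms(2)] by blast
  show f: "affine_line (Suc j)"
    using opposite_point_tangent[OF step(2) Z assms(2)] proj_eq_tgl proj_eq_sym proj_eq_trans
    unfolding affine_line_def by metis
  show "point_coord (Suc j) = 0" using point_coord(1)[OF f] Z proj_eq_pt proj_eq_sym proj_eq_trans by metis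
qed

lemma arrival:
  assumes "affine_line n" "\<not> affine_line (Suc n)"
  shows "point_coord (Suc n) = 0" "proj_eq (P (Suc (Suc n))) (pt 0 1)" "proj_eq (l (Suc (Suc n))) (tgl 1 0)"
proof -
  have l: "proj_eq (l (Suc n)) (tgl 1 0)" using assms(2) by (simp add: affine_line_def)
  have "\<not> proj_eq (P (Suc n)) (pt 0 1)"
    using point_coord(2)[OF assms(1)] proj_eq_pt proj_eq_sym proj_eq_trans by metis
  then have "proj_eq (P (Suc n)) (pt 1 0)" and O: "proj_eq (P (Suc (Suc n))) (pt 0 1)"
    using special_line[OF step(1) l] by auto
  then show "point_coord (Suc n) = 0" using point_coord(2)[OF assms(1)] proj_eq_pt proj_eq_sym proj_eq_trans by metis
  show "proj_eq (P (Suc (Suc n))) (pt 0 1)" by (fact O)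
  show "proj_eq (l (Suc (Suc n))) (tgl 1 0)" by (rule base_point_tangent[OF step(2) O])
qed

text \<open>The excluded tangent has the base point as one of its two ends: either the trajectory
  starts there on this line, or it arrives there and turns back along it.\<close>

lemma base_point_reached:
  assumes "\<not> affine_line n"
  obtains j where "proj_eq (P j) (pt 0 1)" "proj_eq (l j) (tgl 1 0)"
proof -
  have l: "proj_eq (l n) (tgl 1 0)" using assms by (simp add: affine_line_def)
  show ?thesis
  proof (cases "proj_eq (P n) (pt 0 1)")
    case True
    then show ?thesis using l that by blast
  next
    case False
    then have O: "proj_eq (P (Suc n)) (pt 0 1)" using special_line[OF step(1) l] by blast
    show ?thesis by (rule that[OF O base_point_tangent[OF step(2) O]])
  qed
qed

lemma first_return:
  assumes "affine_line (Suc j)" "\<not> affine_line (j + N)" "N > 0"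
  obtains i where "i > 0" "i < N" "\<And>h. h < i \<Longrightarrow> affine_line (Suc j + h)" "affine_line (j + i)" "\<not> affine_line (Suc (j + i))"
proof -
  \<comment> \<open>The length of the run of affine lines that begins with line
    \<open>Suc j\<close>; the index \<open>N - 1\<close> is the offset of line \<open>j + N\<close>
    from there.\<close>
  define M where "M = (LEAST n. \<not> affine_line (Suc j + n))"
  have ex: "\<not> affine_line (Suc j + (N - 1))" using assms(2,3) by simp
  have M: "\<not> affine_line (Suc j + M)" unfolding M_def by (rule LeastI[of _ "N - 1"]) (rule ex)
  have least: "affine_line (Suc j + h)" if "h < M" for h using not_less_Least[of h] that unfolding M_def by blast
  have "M \<le> N - 1" unfolding M_def by (rule Least_le) (rule ex)
  moreover have "M > 0" using M assms(1) by (cases M) auto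
  moreover have "affine_line (j + M)" using least[of "M - 1"] \<open>M > 0\<close> by simp
  ultimately show ?thesis using that[of M] M least assms(3) by simp
qed

text \<open>Affine stretches of length \<open>2 m\<close> close by \<open>chain_closes\<close>. A
  trajectory meeting the excluded tangent passes through the base point, and is shown to come back
  to it soon enough. The bound on \<open>r\<close> is uniform, which later yields one period for all
  trajectories.\<close>

lemma returns:
  assumes sol: "a ^ 2 - [:f0, f1, f2, f3:] * b ^ 2 = smult c ([:0, 1:] ^ (2 * m))" "c \<noteq> 0"
    "poly a 0 \<noteq> 0" and m: "m > 0"
  shows "\<exists>j r. 0 < r \<and> r \<le> 2 * m + 2 \<and> proj_eq (P (j + r)) (P j) \<and> proj_eq (l (j + r)) (l j)"
proof -
  have closes: "point_coord (j + 2 * m) = point_coord j" if f: "\<And>i. i < 2 * m \<Longrightarrow> affine_line (j + i)" for j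
  proof -
    have "point_coord (j + 2 * m) = point_coord (j + 0)"
    proof (rule chain_closes[OF eps f3 _ _ _ m sol])
      fix i
      show "i < 2 * m \<Longrightarrow> f3 * (point_coord (j + i) + point_coord (j + Suc i)) = line_coord (j + i) ^ 2 - f2"
        "i < 2 * m \<Longrightarrow> - f3 * point_coord (j + i) * point_coord (j + Suc i) = 2 * eps * line_coord (j + i) - f1"
        using edge[of "j + i"] f[of i] by auto
      show "Suc i < 2 * m \<Longrightarrow> point_coord (j + Suc i) * (line_coord (j + i) + line_coord (j + Suc i)) = - 2 * eps"
        using vertex[of "j + i"] f[of i] f[of "Suc i"] by simp
    qed
    then show ?thesis by simp
  qed
  show ?thesis
  proof (cases "\<forall>n. affine_line n")
    case True
    \<comment> \<open>Closing from index \<open>0\<close> and from index \<open>1\<close> recovers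
      both ends of the line, and hence its slope by the edge relation.\<close>
    have s: "point_coord (2 * m) = point_coord 0" "point_coord (Suc (2 * m)) = point_coord (Suc 0)"
      using closes[of 0] closes[of 1] True by auto
    have "2 * eps * line_coord (2 * m) = 2 * eps * line_coord 0"
      using edge(2)[of "2 * m"] edge(2)[of 0] True s by simp
    then have "line_coord (2 * m) = line_coord 0" using eps by simp
    then have "proj_eq (l (2 * m)) (l 0)" using line_coord[of "2 * m"] line_coord[of 0] True proj_eq_sym proj_eq_trans by metis
    moreover have "proj_eq (P (2 * m)) (P 0)" using point_coord(1)[of "2 * m"] point_coord(1)[of 0] s True proj_eq_sym proj_eq_trans by metis
    ultimately show ?thesis using m by (intro exI[of _ 0] exI[of _ "2 * m"]) simp
  next
    case False
    then obtain j where j: "proj_eq (P j) (pt 0 1)" "proj_eq (l j) (tgl 1 0)"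
      using base_point_reached by blast
    note dep = departure[OF j]
    \<comment> \<open>Otherwise the stretch starting at the vertex \<open>s = 0\<close> closes up at
      \<open>s = 0\<close> between two affine lines, and the vertex relation there reads
      \<open>0 = - 2 * eps\<close>.\<close>
    have "\<exists>n. 0 < n \<and> n \<le> 2 * m + 1 \<and> \<not> affine_line (j + n)"
    proof (rule ccontr)
      assume "\<not> ?thesis"
      then have f: "affine_line (j + n)" if "0 < n" "n \<le> 2 * m + 1" for n using that by blast
      have "affine_line (Suc j + i)" if "i < 2 * m" for i using f[of "Suc i"] that by simp
      then have "point_coord (Suc (j + 2 * m)) = 0" using closes[of "Suc j"] dep(2) by simp
      moreover have "affine_line (j + 2 * m)" "affine_line (Suc (j + 2 * m))" using f[of "2 * m"] f[of "2 * m + 1"] m by auto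
      ultimately show False using vertex[of "j + 2 * m"] eps by simp
    qed
    then obtain n where n: "0 < n" "n \<le> 2 * m + 1" "\<not> affine_line (j + n)" by blast
    obtain i where i: "i < n" "affine_line (j + i)" "\<not> affine_line (Suc (j + i))"
      using first_return[OF dep(1) n(3,1)] by metis
    note arr = arrival[OF i(2,3)]
    have "proj_eq (P (j + (i + 2))) (P j)" "proj_eq (l (j + (i + 2))) (l j)"
      using proj_eq_trans[OF arr(2) proj_eq_sym[OF j(1)]] proj_eq_trans[OF arr(3) proj_eq_sym[OF j(2)]]
      by simp_all
    then show ?thesis using i n by (intro exI[of _ j] exI[of _ "i + 2"]) simp
  qed
qed

text \<open>The segment between two consecutive visits of the base point is a chain that starts and ends
  over \<open>z = 0\<close>, so its norm is a pure power of \<open>z\<close>.\<close>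

lemma return_norm:
  assumes "proj_eq (P 0) (pt 0 1)" "proj_eq (l 0) (tgl 1 0)" "proj_eq (l N) (l 0)" "N > 0"
  shows "norm_solvable [:f0, f1, f2, f3:]"
proof -
  note dep = departure[OF assms(1,2)]
  have N: "\<not> affine_line (0 + N)" using assms(2,3) proj_eq_trans by (auto simp: affine_line_def)
  then obtain i where i: "i > 0" "\<And>h. h < i \<Longrightarrow> affine_line (Suc 0 + h)" "affine_line (0 + i)" "\<not> affine_line (Suc (0 + i))"
    using first_return[OF dep(1) N assms(4)] by metis
  have ex: "\<exists>a b. a ^ 2 - [:f0, f1, f2, f3:] * b ^ 2 =
           smult ((- f3) ^ i) ([:0, 1:] ^ i * [:- point_coord (Suc 0), 1:] * [:- point_coord (Suc i), 1:]) \<and>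
         poly a 0 = eps * poly b 0 \<and> poly b 0 \<noteq> 0"
  proof (rule chain_norm[OF eps f3 _ _ _ i(1)])
    fix h
    show "h < i \<Longrightarrow> f3 * (point_coord (Suc h) + point_coord (Suc (Suc h))) = line_coord (Suc h) ^ 2 - f2"
      "h < i \<Longrightarrow> - f3 * point_coord (Suc h) * point_coord (Suc (Suc h)) = 2 * eps * line_coord (Suc h) - f1"
      using edge[of "Suc h"] i(2)[of h] by auto
    show "Suc h < i \<Longrightarrow> point_coord (Suc (Suc h)) * (line_coord (Suc h) + line_coord (Suc (Suc h))) = - 2 * eps"
      using vertex[of "Suc h"] i(2)[of h] i(2)[of "Suc h"] by simp
  qed
  \<comment> \<open>Both end vertices of the chain have coordinate \<open>0\<close>, so each
    contributes another factor \<open>z\<close> and the exponent is \<open>i + 2\<close>.\<close>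
  have s: "point_coord (Suc i) = 0" using arrival(1)[OF i(3,4)] by simp
  obtain a b where ab: "a ^ 2 - [:f0, f1, f2, f3:] * b ^ 2 =
      smult ((- f3) ^ i) ([:0, 1:] ^ i * [:0, 1:] * [:0, 1:])"
    "poly a 0 = eps * poly b 0" "poly b 0 \<noteq> 0"
    using ex unfolding s dep(2) minus_zero by blast
  have "a ^ 2 - [:f0, f1, f2, f3:] * b ^ 2 = smult ((- f3) ^ i) ([:0, 1:] ^ (i + 2))"
    unfolding ab(1) by (simp only: power_add power2_eq_square mult.assoc)
  moreover have "a * b \<noteq> 0"
  proof
    assume "a * b = 0"
    then have "poly a 0 * poly b 0 = 0" by (metis poly_0 poly_mult)
    then show False using ab eps by simp
  qed
  ultimately show ?thesis using f3 by (intro norm_solvable_square[of a _ b "(- f3) ^ i" "i + 2"]) auto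
qed

end

lemma nf_B_conic: "conic_matrix B" by (rule nf_conic_matrix(2)) (rule f3)

lemma periodic_imp_norm_solvable:
  assumes "poncelet_periodic A B N"
  shows "norm_solvable [:f0, f1, f2, f3:]"
proof -
  obtain P l where t: "poncelet_trajectory A B P l" "P 0 = pt 0 1" "l 0 = tgl 1 0"
    using poncelet_trajectory_exists[OF nf_A_conic nf_B_conic pt_on_conic(2) tgl_tangent(2) incidence(3)]
    by blast
  moreover have "proj_eq (l N) (l 0)" "N > 0"
    using assms t(1) by (simp_all add: poncelet_periodic_def)
  ultimately show ?thesis using return_norm[OF t(1), of N] by simp
qed

text \<open>Trajectories may return after different numbers \<open>r\<close> of steps, all at most
  \<open>2 * m + 2\<close>; the factorial is an even common multiple.\<close>

lemma norm_imp_periodic: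
  assumes sol: "a ^ 2 - [:f0, f1, f2, f3:] * b ^ 2 = smult c ([:0, 1:] ^ (2 * m))" "c \<noteq> 0"
    "poly a 0 \<noteq> 0" and m: "m > 0"
  shows "\<exists>N. even N \<and> poncelet_periodic A B N"
proof (intro exI[of _ "fact (2 * m + 2)"] conjI)
  show "even (fact (2 * m + 2) :: nat)" by (rule dvd_fact) auto
  show "poncelet_periodic A B (fact (2 * m + 2))"
    unfolding poncelet_periodic_def
  proof (rule conjI, simp, intro allI impI)
    fix P l assume t: "poncelet_trajectory A B P l"
    obtain j r where jr: "0 < r" "r \<le> 2 * m + 2" "proj_eq (P (j + r)) (P j)" "proj_eq (l (j + r)) (l j)"
      using returns[OF t sol m] by blast
    have "r dvd fact (2 * m + 2)" using jr by (intro dvd_fact) auto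
    then show "proj_eq (P (fact (2 * m + 2))) (P 0) \<and> proj_eq (l (fact (2 * m + 2))) (l 0)"
      using trajectory_periodic[OF nf_A_conic t jr(3,4)] by blast
  qed
qed

end

section \<open>Reduction of a transversal pencil to normal form\<close>

text \<open>The implication of the first half as a property of the pair of matrices, so that it can
  be carried along coordinate changes.\<close>

definition period_solves :: "complex ^ 3 ^ 3 \<Rightarrow> complex ^ 3 ^ 3 \<Rightarrow> bool" where
  "period_solves A B \<longleftrightarrow> (\<forall>F N. (\<forall>z. poly F z = det (A - mat z ** B)) \<longrightarrow> poncelet_periodic A B N
     \<longrightarrow> norm_solvable F)"

lemma period_solves_congr:
  assumes S: "det S \<noteq> 0" and sol: "period_solves (congr S A) (congr S B)"
  shows "period_solves A B"
  unfolding period_solves_def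
proof (intro allI impI)
  fix F N assume F: "\<forall>z. poly F z = det (A - mat z ** B)" and per: "poncelet_periodic A B N"
  obtain T where T: "S ** T = mat 1" "T ** S = mat 1"
    using S by (auto simp: invertible_det_nz[symmetric] invertible_def)
  have "\<forall>z. poly (smult (det S ^ 2) F) z = det (congr S A - mat z ** congr S B)"
    using F by (simp add: det_congr_pencil)
  then have "norm_solvable (smult (det S ^ 2) F)"
    using sol congr_poncelet_periodic[OF T per] unfolding period_solves_def by blast
  then show "norm_solvable F" using S by (rule norm_solvable_smult)
qed

lemma det_nonzero_if_ker:
  fixes S :: "complex ^ 3 ^ 3"
  assumes "\<And>x. S *v x = 0 \<Longrightarrow> x = 0"
  shows "det S \<noteq> 0"
  using assms by (metis invertible_det_nz invertible_left_inverse matrix_left_invertible_ker)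

lemma congr_nf_B_nonzero: "conic_matrix (nf_B q :: complex ^ 3 ^ 3) \<Longrightarrow> q \<noteq> 0"
  by (auto simp: conic_matrix_def det_3 nf_B_def)

text \<open>The basis consists of a second point \<open>e\<close> of the conic, the pole
  \<open>u\<close> of the line \<open>e d\<close>, and \<open>d\<close>. The first column is
  recorded so that the choice of \<open>w\<close> can also control the other conic.\<close>

lemma conic_frame:
  assumes B: "conic_matrix B" and d: "d \<in> conic_points B" and w: "scalar_product w (B *v d) = 1"
  obtains S q t where "det S \<noteq> 0" "q \<noteq> 0" "congr S B = nf_B q" "column 3 S = d"
    "column 1 S = w + t *s d"
proof -
  have sym: "scalar_product x (B *v y) = scalar_product y (B *v x)" for x y
    using B scalar_product_symmetric by (auto simp: conic_matrix_def)
  have dd: "scalar_product d (B *v d) = 0" using d by (simp add: conic_points_def)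
  \<comment> \<open>Chosen so that \<open>w + t d\<close> lies on the conic.\<close>
  define t where "t = - scalar_product w (B *v w) / 2"
  define e where "e = w + t *s d"
  have ed: "scalar_product e (B *v d) = 1" by (simp add: e_def scalar_product_simps dd w)
  then have de: "scalar_product d (B *v e) = 1" by (metis sym)
  have dw: "scalar_product d (B *v w) = 1" using w by (metis sym)
  have "scalar_product e (B *v e) = scalar_product w (B *v w) + 2 * t"
    by (simp add: e_def scalar_product_simps matrix_vector_right_distrib vector_scalar_commute dd w dw)
  then have ee: "scalar_product e (B *v e) = 0" by (simp add: t_def)
  define u where "u = crs (B *v e) (B *v d)"
  have ue: "scalar_product u (B *v e) = 0" "scalar_product u (B *v d) = 0"
    using crs_orthogonal scalar_product_commute unfolding u_def by metis+
  then have eu: "scalar_product e (B *v u) = 0" "scalar_product d (B *v u) = 0"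
    by (metis sym)+
  have "scalar_product u (crs d e) = 1"
    unfolding u_def crs_lagrange by (simp add: scalar_product_commute[of "B *v _"] dd de ed ee)
  then have u0: "u \<noteq> 0" by (auto simp: scalar_product_simps)
  define S :: "complex ^ 3 ^ 3" where
    "S = (\<chi> i j. if j = 1 then e $ i else if j = 2 then u $ i else d $ i)"
  have col: "column 1 S = e" "column 2 S = u" "column 3 S = d"
    by (simp_all add: S_def column_def vec_eq_iff)
  have "det S \<noteq> 0"
  proof (rule det_nonzero_if_ker)
    fix x assume x: "S *v x = 0"
    have Sx: "S *v x = x $ 1 *s e + x $ 2 *s u + x $ 3 *s d"
      by (simp add: vec_eq_3 matrix_vector_3 S_def)
    have "scalar_product (S *v x) (B *v d) = x $ 1" "scalar_product (S *v x) (B *v e) = x $ 3"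
      unfolding Sx by (simp_all add: scalar_product_simps ed dd ee de ue)
    then have 0: "x $ 1 = 0" "x $ 3 = 0" using x by (simp_all add: scalar_product_simps)
    then have "x $ 2 *s u = 0" using x unfolding Sx by simp
    then have "x $ 2 = 0" using u0 by simp
    then show "x = 0" using 0 by (simp add: vec_eq_3)
  qed
  moreover have q: "congr S B = nf_B (scalar_product u (B *v u))"
    by (simp add: vec_eq_iff forall_3 congr_component col nf_B_def ee ed de dd eu ue)
  moreover have "scalar_product u (B *v u) \<noteq> 0"
    using congr_conic_matrix[OF B calculation(1)] unfolding q by (rule congr_nf_B_nonzero)
  ultimately show ?thesis using that col by (simp add: e_def)
qed

lemma normal_form_period_solves:
  assumes A: "conic_matrix (nf_A f0 f1 f2)" and f3: "f3 \<noteq> 0"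
  shows "period_solves (nf_A f0 f1 f2) (nf_B f3)"
proof -
  have "f0 \<noteq> 0" using A by (auto simp: conic_matrix_def det_3 nf_A_def)
  then interpret normal_form f0 f1 f2 f3 "csqrt f0"
    using f3 by unfold_locales auto
  show ?thesis
    unfolding period_solves_def
  proof (intro allI impI)
    fix F N assume F: "\<forall>z. poly F z = det (nf_A f0 f1 f2 - mat z ** nf_B f3)"
      and per: "poncelet_periodic (nf_A f0 f1 f2) (nf_B f3) N"
    have "F = [:f0, f1, f2, f3:]"
      by (rule poly_eqI_nonzero)
         (simp add: F det_nf_pencil algebra_simps power2_eq_square power3_eq_cube)
    then show "norm_solvable F" using periodic_imp_norm_solvable[OF per] by simp
  qed
qed

lemma transversal_period_solves:
  assumes A: "conic_matrix A" and B: "conic_matrix B"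
    and d: "d \<in> conic_points A" "d \<in> conic_points B" and tr: "crs (A *v d) (B *v d) \<noteq> 0"
  shows "period_solves A B"
proof -
  obtain e where e: "scalar_product e (crs (A *v d) (B *v d)) = 1" using exists_scalar_product_eq_1[OF tr] ..
  \<comment> \<open>A point on the tangent of \<open>A\<close> at \<open>d\<close> but off that of
    \<open>B\<close>, possible by transversality. Adding a multiple of \<open>d\<close> keeps it on
    the tangent of \<open>A\<close>, which makes the entry \<open>C $ 1 $ 3\<close> vanish.\<close>
  define w where "w = crs e (A *v d)"
  have wB: "scalar_product w (B *v d) = 1"
    using e scalar_product_crs_rotate[of "B *v d" e "A *v d"] by (simp add: w_def scalar_product_commute)
  have wA: "scalar_product w (A *v d) = 0"
    unfolding w_def by (metis crs_orthogonal(2) scalar_product_commute)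
  have dA: "scalar_product d (A *v d) = 0" using d(1) by (simp add: conic_points_def)
  obtain S q t where S: "det S \<noteq> 0" "q \<noteq> 0" "congr S B = nf_B q" "column 3 S = d"
      "column 1 S = w + t *s d"
    using conic_frame[OF B d(2) wB] .
  define C where "C = congr S A"
  have C: "conic_matrix C" using congr_conic_matrix[OF A S(1)] by (simp add: C_def)
  then have sym: "C $ i $ j = C $ j $ i" for i j by (auto simp: conic_matrix_def transpose_def vec_eq_iff)
  have 0: "C $ 3 $ 3 = 0" "C $ 1 $ 3 = 0"
    by (simp_all add: C_def congr_component S(4,5) scalar_product_simps dA wA)
  have "det C = - (C $ 1 $ 1 * C $ 2 $ 3 * C $ 2 $ 3)"
    using sym[of 3 1] sym[of 3 2] 0 by (simp add: det_3)
  then have "C $ 2 $ 3 \<noteq> 0" using C by (auto simp: conic_matrix_def)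
  \<comment> \<open>Rescales the second basis vector so that the entry at \<open>(2, 3)\<close>
    becomes \<open>1\<close>.\<close>
  define T :: "complex ^ 3 ^ 3" where
    "T = vector [vector [1, 0, 0], vector [0, 1 / C $ 2 $ 3, 0], vector [0, 0, 1]]"
  have T: "det T \<noteq> 0" using \<open>C $ 2 $ 3 \<noteq> 0\<close> by (simp add: T_def det_3)
  have "congr T C = nf_A (- C $ 1 $ 1) (- 2 * C $ 1 $ 2 / C $ 2 $ 3) (- C $ 2 $ 2 / (C $ 2 $ 3) ^ 2)"
    using \<open>C $ 2 $ 3 \<noteq> 0\<close> sym[of 2 1] sym[of 3 1] sym[of 3 2] 0
    by (simp add: vec_eq_iff forall_3 congr_component nf_A_def T_def column_def scalar_product_3 matrix_vector_3 power2_eq_square)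
  moreover have "congr T (nf_B q) = nf_B (q / (C $ 2 $ 3) ^ 2)"
    by (simp add: vec_eq_iff forall_3 congr_component nf_B_def T_def column_def scalar_product_3 matrix_vector_3 power2_eq_square)
  ultimately have "period_solves (congr T C) (congr T (nf_B q))"
    using normal_form_period_solves congr_conic_matrix[OF C T] S(2) \<open>C $ 2 $ 3 \<noteq> 0\<close> by simp
  then show ?thesis using period_solves_congr S(1) T unfolding C_def S(3)[symmetric] by blast
qed

section \<open>Pencils without a transversal intersection\<close>

text \<open>The pencil of \<open>tangential z0 q a b c\<close> and \<open>nf_B q\<close> contains the line pair
  \<open>a x\<^sup>2 + 2 b x y + c y\<^sup>2 = 0\<close> through their common point \<open>(0, 0, 1)\<close>. If the two lines differ, one of
  them leads to a transversal intersection.\<close>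

definition tangential :: "complex \<Rightarrow> complex \<Rightarrow> complex \<Rightarrow> complex \<Rightarrow> complex \<Rightarrow> complex ^ 3 ^ 3" where
  "tangential z0 q a b c = vector [vector [a, b, z0], vector [b, z0 * q + c, 0], vector [z0, 0, 0]]"

text \<open>The line joining the points of \<open>nf_B q\<close> with parameters \<open>s\<close>
  and \<open>t\<close>.\<close>

definition chord :: "complex \<Rightarrow> complex \<Rightarrow> complex \<Rightarrow> complex ^ 3" where
  "chord q s t = vector [- q * s * t, q * (s + t), 2]"

lemma nf_point_on_conic: "nf_point q 1 s \<in> conic_points (nf_B q)"
  by (auto simp: nf_conic_points_B nf_point_def vec_eq_3 power2_eq_square)

lemma proj_eq_nf_point: "proj_eq (nf_point q 1 s) (nf_point q 1 t) \<longleftrightarrow> s = t"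
  unfolding proj_eq_def by (auto simp: vec_eq_3 nf_point_def intro!: exI[of _ 1])

lemma chord_incidence: "q \<noteq> 0 \<Longrightarrow> on_line (nf_point q 1 x) (chord q s t) \<longleftrightarrow> x = s \<or> x = t"
proof -
  assume q: "q \<noteq> 0"
  have "scalar_product (chord q s t) (nf_point q 1 x) = - q * ((x - s) * (x - t))"
    by (simp add: scalar_product_3 chord_def nf_point_def algebra_simps power2_eq_square)
  then show ?thesis using q by (simp add: on_line_def)
qed

lemma chord_tangent:
  assumes z0: "z0 \<noteq> 0" and p: "z0 * q + c \<noteq> 0"
    and eq: "q ^ 2 * (s + t) ^ 2 * z0 ^ 2 = 4 * (z0 * q + c) * (q * s * t * z0 + a)"
  shows "tangent_line (tangential z0 q a 0 c) (chord q s t)"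
proof -
  define p where "p = z0 * q + c"
  let ?l = "chord q s t"
  define T :: "complex ^ 3" where
    "T = vector [2 / z0, q * (s + t) / p, (- q * s * t - 2 * a / z0) / z0]"
  have p0: "p \<noteq> 0" using assms by (simp add: p_def)
  have AT: "tangential z0 q a 0 c *v T = ?l"
    using z0 p0 by (simp add: vec_eq_3 matrix_vector_3 tangential_def T_def chord_def flip: p_def)
  have "scalar_product T ?l * (p * z0 ^ 2) = q ^ 2 * (s + t) ^ 2 * z0 ^ 2 - 4 * p * (q * s * t * z0 + a)"
    using z0 p0 by (simp add: scalar_product_3 T_def chord_def field_simps power2_eq_square)
  then have "scalar_product T ?l = 0" using eq z0 p0 by (simp add: p_def)
  moreover have "T \<noteq> 0" using z0 by (auto simp: vec_eq_3 T_def)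
  ultimately have "T \<in> conic_points (tangential z0 q a 0 c)" by (simp add: conic_points_def AT)
  then show ?thesis unfolding tangent_line_def using AT proj_eq_refl by metis
qed

text \<open>A scalar sequence satisfying the tangency condition is a trajectory: distinct neighbours
  give the two points on each line, distinct second neighbours the two tangents through each
  point.\<close>

lemma chord_trajectory:
  assumes A: "conic_matrix (tangential z0 q a 0 c)" and q: "q \<noteq> 0"
    and ne: "\<And>n. s n \<noteq> s (Suc n)" "\<And>n. s n \<noteq> s (Suc (Suc n))"
    and tan: "\<And>n. q ^ 2 * (s n + s (Suc n)) ^ 2 * z0 ^ 2 =
      4 * (z0 * q + c) * (q * s n * s (Suc n) * z0 + a)"
  shows "poncelet_trajectory (tangential z0 q a 0 c) (nf_B q) (\<lambda>n. nf_point q 1 (s n))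
     (\<lambda>n. chord q (s n) (s (Suc n)))"
proof -
  have det: "det (tangential z0 q a 0 c) = - (z0 ^ 2 * (z0 * q + c))"
    by (simp add: det_3 tangential_def power2_eq_square)
  then have z: "z0 \<noteq> 0" "z0 * q + c \<noteq> 0" using A by (auto simp: conic_matrix_def)
  note t = chord_tangent[OF z tan]
  have l0: "chord q x y \<noteq> 0" for x y by (auto simp: vec_eq_3 chord_def)
  have P0: "nf_point q 1 x \<noteq> 0" for x by (auto simp: vec_eq_3 nf_point_def)
  have "line_meets_conic_in (nf_B q) (chord q (s n) (s (Suc n))) (nf_point q 1 (s n)) (nf_point q 1 (s (Suc n)))" for n
    using ne(1)[of n] q
    by (intro line_meets_conic_two nf_conic_matrix(2) l0 nf_point_on_conic)
       (auto simp: chord_incidence proj_eq_nf_point)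
  moreover have "tangents_through (tangential z0 q a 0 c) (nf_point q 1 (s (Suc n)))
      (chord q (s n) (s (Suc n))) (chord q (s (Suc n)) (s (Suc (Suc n))))" for n
  proof (intro tangents_through_two A P0 t)
    show "\<not> proj_eq (chord q (s n) (s (Suc n))) (chord q (s (Suc n)) (s (Suc (Suc n))))"
      using ne(2)[of n] q unfolding proj_eq_def by (auto simp: vec_eq_3 chord_def)
  qed (use q in \<open>auto simp: chord_incidence\<close>)
  ultimately show ?thesis
    unfolding poncelet_trajectory_def using t q by (auto simp: nf_point_on_conic chord_incidence)
qed

text \<open>For \<open>b = c = 0\<close> the tangency condition reads
  \<open>(s - t)^2 = 4 a / (q z0)\<close>, so an arithmetic progression is a trajectory; it never
  returns.\<close>

lemma parabolic_not_periodic: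
  assumes A: "conic_matrix (tangential z0 q a 0 0)" and q: "q \<noteq> 0" and a: "a \<noteq> 0"
  shows "\<not> poncelet_periodic (tangential z0 q a 0 0) (nf_B q) N"
proof
  assume per: "poncelet_periodic (tangential z0 q a 0 0) (nf_B q) N"
  have z0: "z0 \<noteq> 0" using A by (auto simp: conic_matrix_def det_3 tangential_def)
  define h where "h = csqrt (4 * a / (q * z0))"
  have h: "h ^ 2 * (q * z0) = 4 * a" using q z0 by (simp add: h_def)
  then have h0: "h \<noteq> 0" using a by auto
  define s where "s = (\<lambda>n. of_nat n * h)"
  have "poncelet_trajectory (tangential z0 q a 0 0) (nf_B q) (\<lambda>n. nf_point q 1 (s n))
     (\<lambda>n. chord q (s n) (s (Suc n)))"
  proof (rule chord_trajectory[OF A q])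
    fix n
    show "s n \<noteq> s (Suc n)" "s n \<noteq> s (Suc (Suc n))" using h0 by (simp_all add: s_def algebra_simps)
    have "q ^ 2 * (s n + s (Suc n)) ^ 2 * z0 ^ 2 - 4 * (z0 * q) * (q * s n * s (Suc n) * z0)
        = (z0 * q) * ((s (Suc n) - s n) ^ 2 * (q * z0))"
      by (simp add: algebra_simps power2_eq_square)
    also have "s (Suc n) - s n = h" by (simp add: s_def algebra_simps)
    finally show "q ^ 2 * (s n + s (Suc n)) ^ 2 * z0 ^ 2 =
      4 * (z0 * q + 0) * (q * s n * s (Suc n) * z0 + a)" unfolding h by (simp add: algebra_simps)
  qed
  then have "proj_eq (nf_point q 1 (s N)) (nf_point q 1 (s 0))"
    using per unfolding poncelet_periodic_def by blast
  then have "s N = s 0" by (simp only: proj_eq_nf_point)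
  moreover have "N > 0" using per by (simp add: poncelet_periodic_def)
  ultimately show False using h0 by (simp add: s_def)
qed

text \<open>The power is expanded in \<open>1\<close> and \<open>v\<close> over the polynomials in
  \<open>z\<close>. One pair of polynomials serves both roots \<open>v\<close> and
  \<open>- v\<close>, which gives the conjugate as well.\<close>

lemma rational_norm:
  fixes z1 \<zeta> :: complex
  shows "\<exists>\<alpha> \<beta>. \<forall>v z. v ^ 2 = z1 - z \<longrightarrow> poly \<alpha> z + v * poly \<beta> z = (v - \<zeta>) ^ n"
proof (induction n)
  case 0
  show ?case by (intro exI[of _ 1] exI[of _ 0]) simp
next
  case (Suc n)
  then obtain \<alpha> \<beta> where IH: "\<And>v z. v ^ 2 = z1 - z \<Longrightarrow> poly \<alpha> z + v * poly \<beta> z = (v - \<zeta>) ^ n" by blast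
  show ?case
  proof (rule exI[of _ "smult (- \<zeta>) \<alpha> + [:z1, - 1:] * \<beta>"], rule exI[of _ "\<alpha> - smult \<zeta> \<beta>"],
      intro allI impI)
    fix v z assume v: "v ^ 2 = z1 - z"
    have "poly (smult (- \<zeta>) \<alpha> + [:z1, - 1:] * \<beta>) z + v * poly (\<alpha> - smult \<zeta> \<beta>) z
        = - \<zeta> * poly \<alpha> z + v ^ 2 * poly \<beta> z + v * (poly \<alpha> z - \<zeta> * poly \<beta> z)"
      unfolding v by (simp add: algebra_simps)
    also have "\<dots> = (v - \<zeta>) * (poly \<alpha> z + v * poly \<beta> z)" by (simp add: algebra_simps power2_eq_square)
    finally show "poly (smult (- \<zeta>) \<alpha> + [:z1, - 1:] * \<beta>) z + v * poly (\<alpha> - smult \<zeta> \<beta>) z = (v - \<zeta>) ^ Suc n"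
      using IH[OF v] by simp
  qed
qed

text \<open>The curve \<open>y^2 = F\<close> has a node at \<open>z0\<close> and the parameter
  \<open>v\<close> with \<open>v^2 = z1 - z\<close>; \<open>y\<close> is a constant times
  \<open>(z - z0) v\<close>. The function \<open>(v - \<zeta>)^N\<close> has norm
  \<open>z^N\<close>, and it is a polynomial in \<open>z\<close> and \<open>y\<close> because it
  agrees on the two branches \<open>v = u0\<close> and \<open>v = - u0\<close> of the node.\<close>

lemma hyperbolic_norm_solvable:
  fixes z0 z1 q u0 \<zeta> :: complex
  assumes q: "q \<noteq> 0" and u0: "u0 ^ 2 = z1 - z0" "u0 \<noteq> 0" and \<zeta>: "\<zeta> ^ 2 = z1" "\<zeta> \<noteq> 0"
    and N: "(u0 - \<zeta>) ^ N = (- u0 - \<zeta>) ^ N" "N > 0"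
    and F: "F = smult (- q) ([:- z0, 1:] ^ 2 * [:z1, - 1:])"
  shows "norm_solvable F"
proof -
  obtain \<alpha> \<beta> where ab: "\<And>v z. v ^ 2 = z1 - z \<Longrightarrow> poly \<alpha> z + v * poly \<beta> z = (v - \<zeta>) ^ N"
    using rational_norm by blast
  have ab': "poly \<alpha> z - v * poly \<beta> z = (- v - \<zeta>) ^ N" if "v ^ 2 = z1 - z" for v z
    using ab[of "- v" z] that by simp
  have norm: "\<alpha> ^ 2 - [:z1, - 1:] * \<beta> ^ 2 = [:0, 1:] ^ N"
  proof (rule poly_eqI_nonzero)
    fix z :: complex
    define v where "v = csqrt (z1 - z)"
    have v: "v ^ 2 = z1 - z" by (simp add: v_def)
    have "poly (\<alpha> ^ 2 - [:z1, - 1:] * \<beta> ^ 2) z = poly \<alpha> z ^ 2 - v ^ 2 * poly \<beta> z ^ 2"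
      unfolding v by (simp add: algebra_simps)
    also have "\<dots> = (poly \<alpha> z + v * poly \<beta> z) * (poly \<alpha> z - v * poly \<beta> z)"
      by (simp add: algebra_simps power2_eq_square)
    also have "\<dots> = ((v - \<zeta>) * (- v - \<zeta>)) ^ N" using ab[OF v] ab'[OF v] by (simp add: power_mult_distrib)
    also have "(v - \<zeta>) * (- v - \<zeta>) = \<zeta> ^ 2 - v ^ 2" by (simp add: algebra_simps power2_eq_square)
    finally show "poly (\<alpha> ^ 2 - [:z1, - 1:] * \<beta> ^ 2) z = poly ([:0, 1:] ^ N) z"
      by (simp add: v \<zeta>)
  qed
  have "u0 * poly \<beta> z0 = - (u0 * poly \<beta> z0)"
    using ab[OF u0(1)] ab'[OF u0(1)] N(1) by (simp add: algebra_simps)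
  then have "poly \<beta> z0 = 0" using u0(2) by (simp add: eq_neg_iff_add_eq_0)
  then obtain \<gamma> where \<gamma>: "\<beta> = [:- z0, 1:] * \<gamma>" by (auto simp: poly_eq_0_iff_dvd)
  have z: "\<zeta> ^ 2 = z1 - 0" using \<zeta> by simp
  have 0: "poly \<alpha> 0 + \<zeta> * poly \<beta> 0 = 0" "poly \<alpha> 0 - \<zeta> * poly \<beta> 0 \<noteq> 0"
    using ab[OF z] ab'[OF z] N(2) \<zeta>(2) by auto
  then have nz: "\<alpha> \<noteq> 0" "\<gamma> \<noteq> 0" by (auto simp: \<gamma>)
  \<comment> \<open>Absorbs the constant \<open>- q\<close> of \<open>F\<close> into the second
    component.\<close>
  define r where "r = csqrt (- 1 / q)"
  have r: "r ^ 2 * (- q) = 1" using q by (simp add: r_def)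
  then have r0: "r \<noteq> 0" by auto
  have "smult (- q) (U ^ 2 * V) * (smult r \<gamma>) ^ 2 = smult (r ^ 2 * (- q)) (V * (U * \<gamma>) ^ 2)" for U V
    by (simp add: power2_eq_square mult_ac)
  then have "F * (smult r \<gamma>) ^ 2 = smult (r ^ 2 * (- q)) ([:z1, - 1:] * \<beta> ^ 2)"
    unfolding F \<gamma> .
  then have "\<alpha> ^ 2 - F * (smult r \<gamma>) ^ 2 = smult 1 ([:0, 1:] ^ N)"
    by (simp only: r norm smult_1_left)
  then show ?thesis by (rule norm_solvable_square) (use nz r0 in auto)
qed

text \<open>For \<open>a = b = 0\<close> the tangency condition is homogeneous in \<open>s\<close>
  and \<open>t\<close>, so a geometric progression with ratio \<open>w\<close> is a trajectory. Its
  period makes \<open>w\<close> a root of unity, which is the node condition of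
  \<open>hyperbolic_norm_solvable\<close>.\<close>

lemma hyperbolic_period_solves:
  assumes A: "conic_matrix (tangential z0 q 0 0 c)" and q: "q \<noteq> 0" and c: "c \<noteq> 0"
  shows "period_solves (tangential z0 q 0 0 c) (nf_B q)"
  unfolding period_solves_def
proof (intro allI impI)
  fix F N assume F: "\<forall>z. poly F z = det (tangential z0 q 0 0 c - mat z ** nf_B q)"
    and per: "poncelet_periodic (tangential z0 q 0 0 c) (nf_B q) N"
  have "det (tangential z0 q 0 0 c) = - (z0 ^ 2 * (z0 * q + c))"
    by (simp add: det_3 tangential_def power2_eq_square)
  then have z0: "z0 \<noteq> 0" and p: "z0 * q + c \<noteq> 0" using A by (auto simp: conic_matrix_def)
  define z1 where "z1 = z0 + c / q"
  define u0 where "u0 = csqrt (c / q)"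
  define \<zeta> where "\<zeta> = csqrt z1"
  have u0: "u0 ^ 2 = z1 - z0" "u0 \<noteq> 0" using q c by (auto simp: u0_def z1_def)
  have qz1: "z0 * q + c = q * z1" using q by (simp add: z1_def field_simps)
  have \<zeta>: "\<zeta> ^ 2 = z1" "\<zeta> \<noteq> 0" using p qz1 by (auto simp: \<zeta>_def)
  have prod: "(\<zeta> - u0) * (\<zeta> + u0) = z0"
    using u0(1) \<zeta>(1) by (simp add: algebra_simps power2_eq_square)
  then have sum0: "\<zeta> + u0 \<noteq> 0" and diff0: "\<zeta> - u0 \<noteq> 0" using z0 by auto
  \<comment> \<open>A root of \<open>(1 + w)^2 z0 = 4 z1 w\<close>, the tangency condition for the
    parameters \<open>s\<close> and \<open>w s\<close>.\<close>
  define w where "w = (\<zeta> - u0) / (\<zeta> + u0)"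
  have w0: "w \<noteq> 0" using diff0 sum0 by (simp add: w_def)
  have w1: "w \<noteq> 1" using u0(2) sum0 by (simp add: w_def)
  have "w \<noteq> - 1"
  proof
    assume "w = - 1"
    then have "\<zeta> - u0 = - (\<zeta> + u0)" using sum0 by (simp add: w_def divide_eq_eq)
    then have "2 * \<zeta> = 0" by (simp add: algebra_simps)
    then show False using \<zeta>(2) by simp
  qed
  with w1 have w2: "w ^ 2 \<noteq> 1" by (simp add: power2_eq_1_iff)
  have w1': "(1 + w) * (\<zeta> + u0) = 2 * \<zeta>" using sum0 by (simp add: w_def field_simps)
  have "(1 + w) ^ 2 * z0 * (\<zeta> + u0) ^ 2 = ((1 + w) * (\<zeta> + u0)) ^ 2 * z0"
    by (simp only: power_mult_distrib mult_ac)
  also have "\<dots> = 4 * z1 * ((\<zeta> - u0) * (\<zeta> + u0))"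
    unfolding w1' prod using \<zeta>(1) by (simp add: power_mult_distrib)
  also have "\<dots> = 4 * z1 * w * (\<zeta> + u0) ^ 2" using sum0 by (simp add: w_def power2_eq_square)
  finally have rel: "(1 + w) ^ 2 * z0 = 4 * z1 * w" using sum0 by simp
  have t: "poncelet_trajectory (tangential z0 q 0 0 c) (nf_B q) (\<lambda>n. nf_point q 1 (w ^ n))
     (\<lambda>n. chord q (w ^ n) (w ^ Suc n))"
  proof (rule chord_trajectory[OF A q])
    fix n
    show "w ^ n \<noteq> w ^ Suc n" "w ^ n \<noteq> w ^ Suc (Suc n)"
      using w0 w1 w2 by (simp_all add: power2_eq_square)
    have "q ^ 2 * (w ^ n + w ^ Suc n) ^ 2 * z0 ^ 2 = q ^ 2 * z0 * (w ^ n) ^ 2 * ((1 + w) ^ 2 * z0)"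
      by (simp add: algebra_simps power2_eq_square)
    also have "\<dots> = 4 * (z0 * q + c) * (q * w ^ n * w ^ Suc n * z0 + 0)"
      unfolding rel qz1 by (simp add: algebra_simps power2_eq_square)
    finally show "q ^ 2 * (w ^ n + w ^ Suc n) ^ 2 * z0 ^ 2 =
      4 * (z0 * q + c) * (q * w ^ n * w ^ Suc n * z0 + 0)" .
  qed
  have N: "N > 0" using per by (simp add: poncelet_periodic_def)
  have "proj_eq (nf_point q 1 (w ^ N)) (nf_point q 1 (w ^ 0))"
    using per t unfolding poncelet_periodic_def by blast
  then have "w ^ N = 1" by (simp only: proj_eq_nf_point power_0)
  have "(u0 - \<zeta>) ^ N = (w * (- u0 - \<zeta>)) ^ N"
  proof -
    have "w * (\<zeta> + u0) = \<zeta> - u0" using sum0 by (simp add: w_def)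
    then have "w * (- u0 - \<zeta>) = u0 - \<zeta>" by (simp add: algebra_simps)
    then show ?thesis by simp
  qed
  then have pow: "(u0 - \<zeta>) ^ N = (- u0 - \<zeta>) ^ N" using \<open>w ^ N = 1\<close> by (simp add: power_mult_distrib)
  have "F = smult (- q) ([:- z0, 1:] ^ 2 * [:z1, - 1:])"
  proof (rule poly_eqI_nonzero)
    fix z :: complex
    have "poly F z = - ((z0 - z) ^ 2 * ((z0 - z) * q + c))"
      unfolding F[rule_format]
      by (simp only: det_3 pencil_component)
         (simp add: tangential_def nf_B_def algebra_simps power2_eq_square)
    also have "(z0 - z) * q + c = q * (z1 - z)" using qz1 by (simp add: algebra_simps)
    finally show "poly F z = poly (smult (- q) ([:- z0, 1:] ^ 2 * [:z1, - 1:])) z"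
      by (simp add: algebra_simps power2_eq_square)
  qed
  then show "norm_solvable F" by (rule hyperbolic_norm_solvable[OF q u0 \<zeta> pow N])
qed

text \<open>\<open>A - z0 B\<close> maps \<open>nf_point q 1 s\<close> to
  \<open>(a + b s, b + c s, 0)\<close>, half the gradient of the binary form. If this is nonzero,
  the tangents of the two conics there differ.\<close>

lemma tangential_transversal:
  assumes A: "conic_matrix (tangential z0 q a b c)" and q: "q \<noteq> 0"
    and s: "a + 2 * b * s + c * s ^ 2 = 0" "a + b * s \<noteq> 0 \<or> b + c * s \<noteq> 0"
  shows "period_solves (tangential z0 q a b c) (nf_B q)"
proof (rule transversal_period_solves[OF A nf_conic_matrix(2)[OF q]])
  let ?d = "nf_point q 1 s"
  show "?d \<in> conic_points (nf_B q)" by (rule nf_point_on_conic)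
  have "scalar_product ?d (tangential z0 q a b c *v ?d) = a + 2 * b * s + c * s ^ 2"
    by (simp add: scalar_product_3 matrix_vector_3 tangential_def nf_point_def algebra_simps power2_eq_square)
  then show "?d \<in> conic_points (tangential z0 q a b c)"
    using s(1) by (auto simp: conic_points_def vec_eq_3 nf_point_def)
  have "crs (tangential z0 q a b c *v ?d) (nf_B q *v ?d) $ 1 = b + c * s"
    "crs (tangential z0 q a b c *v ?d) (nf_B q *v ?d) $ 2 = - (a + b * s)"
    by (simp_all add: crs_component matrix_vector_3 tangential_def nf_point_def nf_B_def algebra_simps power2_eq_square)
  then show "crs (tangential z0 q a b c *v ?d) (nf_B q *v ?d) \<noteq> 0"
    using s(2) by (metis neg_equal_0_iff_equal zero_index)
qed

text \<open>The line pair degenerates to a double line through the common point in two ways: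
  \<open>b = c = 0\<close> is the parabolic case, and \<open>c \<noteq> 0\<close> with zero
  discriminant the hyperbolic one. In all other cases a simple line of the pair provides a
  transversal intersection.\<close>

lemma tangential_period_solves:
  assumes A: "conic_matrix (tangential z0 q a b c)" and q: "q \<noteq> 0"
    and ne: "conic_points (tangential z0 q a b c) \<noteq> conic_points (nf_B q)"
  shows "period_solves (tangential z0 q a b c) (nf_B q)"
proof (cases "c = 0")
  case c: True
  show ?thesis
  proof (cases "b = 0")
    case b: True
    have z0: "z0 \<noteq> 0" using A by (auto simp: conic_matrix_def det_3 tangential_def)
    have "a \<noteq> 0"
    proof
      assume "a = 0"
      then have "scalar_product X (tangential z0 q a b c *v X) = z0 * scalar_product X (nf_B q *v X)" for X
        using b c by (simp add: scalar_product_3 matrix_vector_3 tangential_def nf_B_def algebra_simps)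
      then show False using ne z0 by (simp add: conic_points_def)
    qed
    then show ?thesis using parabolic_not_periodic[of z0 q a] A q b c by (simp add: period_solves_def)
  next
    case False
    then show ?thesis using c by (intro tangential_transversal[OF A q, of "- a / (2 * b)"]) auto
  qed
next
  case c: False
  define t where "t = - b / c"
  \<comment> \<open>An automorphism of \<open>nf_B q\<close> fixing \<open>(0, 0, 1)\<close> and
    shifting the parameter \<open>s\<close> by \<open>t\<close>; it completes the square in the
    binary form.\<close>
  define S :: "complex ^ 3 ^ 3" where
    "S = vector [vector [1, 0, 0], vector [t, 1, 0], vector [- q * t ^ 2 / 2, - q * t, 1]]"
  have S: "det S \<noteq> 0" by (simp add: S_def det_3)
  have ct: "c * t = - b" "c * (t * x) = - (b * x)" for x using c by (simp_all add: t_def)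
  have SB: "congr S (nf_B q) = nf_B q"
    by (simp add: vec_eq_iff forall_3 congr_component nf_B_def S_def column_def scalar_product_3 matrix_vector_3 power2_eq_square)
  have SA: "congr S (tangential z0 q a b c) = tangential z0 q (a + b * t) 0 c"
    by (simp add: vec_eq_iff forall_3 congr_component tangential_def S_def column_def scalar_product_3 matrix_vector_3
        power2_eq_square algebra_simps ct)
  define a' where "a' = a + b * t"
  have A': "conic_matrix (tangential z0 q a' 0 c)"
    using congr_conic_matrix[OF A S] by (simp add: SA a'_def)
  have "period_solves (tangential z0 q a' 0 c) (nf_B q)"
  proof (cases "a' = 0")
    case True
    then show ?thesis using hyperbolic_period_solves[of z0 q c] A' q c by simp
  next
    case False
    then show ?thesis
      using c by (intro tangential_transversal[OF A' q, of "csqrt (- a' / c)"]) auto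
  qed
  then show ?thesis using period_solves_congr[OF S] by (simp add: SA SB a'_def)
qed

section \<open>Common points and arbitrary pencils\<close>

text \<open>The form is restricted to the line where the third coordinate vanishes, and the
  quadratic formula applies.\<close>

lemma conic_has_point: "conic_points (M :: complex ^ 3 ^ 3) \<noteq> {}" if "transpose M = M"
proof (cases "M $ 1 $ 1 = 0")
  case True
  then have "vector [1, 0, 0] \<in> conic_points M"
    by (auto simp: conic_points_def vec_eq_3 scalar_product_3 matrix_vector_3)
  then show ?thesis by blast
next
  case False
  have sym: "M $ 2 $ 1 = M $ 1 $ 2" using that by (auto simp: transpose_def vec_eq_iff)
  define D where "D = csqrt (M $ 1 $ 2 ^ 2 - M $ 1 $ 1 * M $ 2 $ 2)"
  have D: "D * D = M $ 1 $ 2 * M $ 1 $ 2 - M $ 1 $ 1 * M $ 2 $ 2"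
    using power2_csqrt[of "M $ 1 $ 2 ^ 2 - M $ 1 $ 1 * M $ 2 $ 2"] by (simp add: D_def power2_eq_square)
  let ?X = "vector [D - M $ 1 $ 2, M $ 1 $ 1, 0] :: complex ^ 3"
  have "scalar_product ?X (M *v ?X) =
      M $ 1 $ 1 * (D * D - (M $ 1 $ 2 * M $ 1 $ 2 - M $ 1 $ 1 * M $ 2 $ 2))"
    by (simp add: scalar_product_3 matrix_vector_3 sym algebra_simps)
  then have "?X \<in> conic_points M" using False by (simp add: conic_points_def vec_eq_3 D)
  then show ?thesis by blast
qed

text \<open>Substituting the parametrisation of \<open>nf_B q\<close> into the form of
  \<open>A\<close> gives a polynomial of degree four, unless \<open>(0, 0, 1)\<close> itself is
  common.\<close>

lemma common_point:
  assumes q: "q \<noteq> 0"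
  shows "conic_points A \<inter> conic_points (nf_B q) \<noteq> {}"
proof (cases "A $ 3 $ 3 = 0")
  case True
  then have "vector [0, 0, 1] \<in> conic_points A \<inter> conic_points (nf_B q)"
    by (auto simp: conic_points_def vec_eq_3 scalar_product_3 matrix_vector_3 nf_B_def)
  then show ?thesis by blast
next
  case False
  let ?p = "[:A $ 1 $ 1, A $ 1 $ 2 + A $ 2 $ 1, A $ 2 $ 2 - q / 2 * (A $ 1 $ 3 + A $ 3 $ 1),
     - q / 2 * (A $ 2 $ 3 + A $ 3 $ 2), q ^ 2 / 4 * A $ 3 $ 3:]"
  have "\<not> constant (poly ?p)" using False q by (simp add: constant_degree)
  then obtain x where x: "poly ?p x = 0" using fundamental_theorem_of_algebra by blast
  have "scalar_product (nf_point q 1 x) (A *v nf_point q 1 x) = poly ?p x"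
    by (simp add: scalar_product_3 matrix_vector_3 nf_point_def algebra_simps power2_eq_square)
  then have "nf_point q 1 x \<in> conic_points A" using x by (auto simp: conic_points_def vec_eq_3 nf_point_def)
  then show ?thesis using nf_point_on_conic by blast
qed

lemma congr_conic_points_eq:
  assumes "det S \<noteq> 0" "conic_points (congr S A) = conic_points (congr S B)"
  shows "conic_points A = conic_points B"
proof -
  obtain T where T: "S ** T = mat 1" "T ** S = mat 1"
    using assms(1) by (auto simp: invertible_det_nz[symmetric] invertible_def)
  have "X \<in> conic_points M \<longleftrightarrow> T *v X \<in> conic_points (congr S M)" for X M
    by (simp add: congr_conic_points[OF T] inverse_simps(1)[OF T])
  then show ?thesis using assms(2) by blast
qed

text \<open>Any common point \<open>d\<close> will do: either the tangents there differ, or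
  \<open>A d = z0 B d\<close> and a frame of \<open>B\<close> at \<open>d\<close> brings the pair
  into tangential form.\<close>

lemma conics_period_solves:
  assumes A: "conic_matrix A" and B: "conic_matrix B" and ne: "conic_points A \<noteq> conic_points B"
  shows "period_solves A B"
proof -
  have unit: "\<exists>w. scalar_product w (M *v d) = 1" if "conic_matrix M" "d \<in> conic_points M" for M d
    using that conic_matrix_ker exists_scalar_product_eq_1 by (metis (mono_tags) conic_points_def mem_Collect_eq)
  have "\<exists>d. d \<in> conic_points A \<and> d \<in> conic_points B"
  proof -
    obtain b where b: "b \<in> conic_points B" using conic_has_point[of B] B by (auto simp: conic_matrix_def)
    obtain w where w: "scalar_product w (B *v b) = 1" using unit[OF B b] ..
    obtain S q t where S: "det S \<noteq> 0" "q \<noteq> 0" "congr S B = nf_B q" using conic_frame[OF B b w] by metis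
    obtain T where T: "S ** T = mat 1" "T ** S = mat 1"
      using S(1) by (auto simp: invertible_det_nz[symmetric] invertible_def)
    obtain d where "d \<in> conic_points (congr S A)" "d \<in> conic_points (congr S B)"
      using common_point[OF S(2), of "congr S A"] S(3) by auto
    then show ?thesis by (auto simp: congr_conic_points[OF T])
  qed
  then obtain d where d: "d \<in> conic_points A" "d \<in> conic_points B" by blast
  show ?thesis
  proof (cases "crs (B *v d) (A *v d) = 0")
    case False
    then have "crs (A *v d) (B *v d) \<noteq> 0" using crs_swap[of "B *v d" "A *v d"] by auto
    then show ?thesis by (rule transversal_period_solves[OF A B d])
  next
    case True
    have "B *v d \<noteq> 0" using d(2) conic_matrix_ker[OF B] by (auto simp: conic_points_def)
    then obtain z0 where z0: "A *v d = z0 *s (B *v d)" using crs_eq_0[OF True] by blast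
    obtain w where w: "scalar_product w (B *v d) = 1" using unit[OF B d(2)] ..
    obtain S q t where S: "det S \<noteq> 0" "q \<noteq> 0" "congr S B = nf_B q" "column 3 S = d"
      using conic_frame[OF B d(2) w] by metis
    define C where "C = congr S A"
    have C: "conic_matrix C" using congr_conic_matrix[OF A S(1)] by (simp add: C_def)
    then have sym: "C $ i $ j = C $ j $ i" for i j by (auto simp: conic_matrix_def transpose_def vec_eq_iff)
    have "C $ i $ 3 = z0 * nf_B q $ i $ 3" for i
      unfolding C_def S(3)[symmetric] by (simp add: congr_component S(4) z0 scalar_product_simps)
    then have c3: "C $ 1 $ 3 = z0" "C $ 2 $ 3 = 0" "C $ 3 $ 3 = 0" by (simp_all add: nf_B_def)
    have eq: "C = tangential z0 q (C $ 1 $ 1) (C $ 1 $ 2) (C $ 2 $ 2 - z0 * q)"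
      using c3 sym[of 3 1] sym[of 3 2] sym[of 2 1] by (simp add: vec_eq_iff forall_3 tangential_def)
    have "conic_points C \<noteq> conic_points (nf_B q)"
      using congr_conic_points_eq[OF S(1)] ne unfolding C_def S(3)[symmetric] by blast
    then have "period_solves C (nf_B q)"
      using tangential_period_solves[OF _ S(2)] C eq by metis
    then show ?thesis using period_solves_congr[OF S(1)] unfolding C_def S(3)[symmetric] by blast
  qed
qed


section \<open>Realisation of a polynomial by real conics\<close>

lemma poly_eq_reversal:
  fixes p q :: "'a :: {field_char_0} poly"
  assumes "\<And>t. t \<noteq> 0 \<Longrightarrow> poly q t = t ^ 4 * poly p (1 / t)" "degree p \<le> 3"
  shows "q = [:0, coeff p 3, coeff p 2, coeff p 1, coeff p 0:]"
proof (rule poly_eqI_nonzero)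
  fix t :: 'a assume t: "t \<noteq> 0"
  have "p = [:coeff p 0, coeff p 1, coeff p 2, coeff p 3:]"
    using assms(2) by (intro poly_eqI) (auto simp: coeff_pCons coeff_eq_0 eval_nat_numeral split: nat.split)
  then have "poly p (1 / t) = poly [:coeff p 0, coeff p 1, coeff p 2, coeff p 3:] (1 / t)"
    by (rule arg_cong)
  then show "poly q t = poly [:0, coeff p 3, coeff p 2, coeff p 1, coeff p 0:] t"
    using assms(1)[OF t] t by (simp add: field_simps eval_nat_numeral)
qed

lemma complexify_nf: "complexify (nf_A f0 f1 f2) = nf_A (of_real f0) (of_real f1) (of_real f2)"
  "complexify (nf_B f3) = nf_B (of_real f3)"
  by (simp_all add: vec_eq_iff forall_3 complexify_def nf_A_def nf_B_def)

text \<open>The normal form has real entries for real \<open>F\<close>; only the root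
  \<open>eps\<close> of \<open>f0\<close> requires complex numbers. The leading coefficient
  \<open>f0\<close> of \<open>R\<close> and \<open>f3\<close> of \<open>F\<close> being nonzero
  makes both matrices nondegenerate.\<close>

lemma realize_by_conics:
  fixes R F :: "real poly"
  assumes R: "degree R = 4" "coeff R 0 = 0" and F: "\<And>s. s \<noteq> 0 \<Longrightarrow> poly F s = s ^ 4 * poly R (1 / s)" "degree F = 3"
  shows "\<exists>(M\<^sub>A :: real ^ 3 ^ 3) (M\<^sub>B :: real ^ 3 ^ 3).
     conic_matrix M\<^sub>A \<and> conic_matrix M\<^sub>B \<and>
     conic_points (complexify M\<^sub>A) \<noteq> conic_points (complexify M\<^sub>B) \<and>
     (\<forall>z. det (M\<^sub>A - mat z ** M\<^sub>B) = poly F z) \<and>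
     (pell_abel_solvable (map_poly complex_of_real R) \<longrightarrow>
       (\<exists>N. even N \<and> poncelet_periodic (complexify M\<^sub>A) (complexify M\<^sub>B) N))"
proof -
  define f0 f1 f2 f3 where f: "f0 = coeff F 0" "f1 = coeff F 1" "f2 = coeff F 2" "f3 = coeff F 3"
  have "poly R t = t ^ 4 * poly F (1 / t)" if "t \<noteq> 0" for t
    using F(1)[of "1 / t"] that by (simp add: power_one_over)
  then have Req: "R = [:0, f3, f2, f1, f0:]"
    using poly_eq_reversal[of R F] F(2) by (simp add: f)
  have f0: "f0 \<noteq> 0" using R(1) unfolding Req by (auto split: if_splits)
  have f3: "f3 \<noteq> 0" using F(2) f(4) by (metis leading_coeff_0_iff degree_0 zero_neq_numeral)
  have Feq: "F = [:f0, f1, f2, f3:]"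
    using F(2) unfolding f
    by (intro poly_eqI) (auto simp: coeff_pCons coeff_eq_0 eval_nat_numeral split: nat.split)
  define \<phi> where "\<phi> = complex_of_real"
  interpret normal_form "\<phi> f0" "\<phi> f1" "\<phi> f2" "\<phi> f3" "csqrt (\<phi> f0)"
    using f0 f3 by unfold_locales (auto simp: \<phi>_def)
  let ?F = "[:\<phi> f0, \<phi> f1, \<phi> f2, \<phi> f3:]"
  have F': "degree ?F = 3" using f3 by (simp add: \<phi>_def)
  have R': "map_poly complex_of_real R = [:0, \<phi> f3, \<phi> f2, \<phi> f1, \<phi> f0:]"
    unfolding Req by (simp add: map_poly_pCons \<phi>_def)
  have R'': "degree [:0, \<phi> f3, \<phi> f2, \<phi> f1, \<phi> f0:] = 4" using f0 by (simp add: \<phi>_def)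
  have RF: "poly [:0, \<phi> f3, \<phi> f2, \<phi> f1, \<phi> f0:] t = t ^ 4 * poly ?F (1 / t)" if "t \<noteq> 0" for t
    using that by (simp add: field_simps eval_nat_numeral)
  \<comment> \<open>The form of \<open>A\<close> takes the value \<open>- F(x)\<close> at the point
    \<open>pt 1 x\<close> of \<open>B\<close>, and \<open>F\<close> is not identically zero.\<close>
  have "conic_points A \<noteq> conic_points B"
  proof -
    have "finite {x. poly ?F x = 0}" using F' by (intro poly_roots_finite) auto
    then obtain x where x: "poly ?F x \<noteq> 0" using infinite_UNIV_char_0[where 'a = complex]
      by (metis (mono_tags) UNIV_eq_I mem_Collect_eq)
    have "scalar_product (pt 1 x) (A *v pt 1 x) = - poly ?F x"
      by (simp add: scalar_product_3 matrix_vector_3 nf_A_def nf_point_def algebra_simps power2_eq_square)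
    then have "pt 1 x \<notin> conic_points A" using x
      by (metis (mono_tags) conic_points_def mem_Collect_eq neg_equal_0_iff_equal)
    then show ?thesis using pt_on_conic(1) by blast
  qed
  moreover have "\<exists>N. even N \<and> poncelet_periodic A B N" if "pell_abel_solvable (map_poly complex_of_real R)"
    using pell_abel_imp_norm[OF F' RF R'' that[unfolded R']] norm_imp_periodic by metis
  moreover have "poly F z = f0 + f1 * z + f2 * z ^ 2 + f3 * z ^ 3" for z
    unfolding Feq by (simp add: algebra_simps power2_eq_square power3_eq_cube)
  ultimately show ?thesis using nf_conic_matrix(1)[of f0 f1 f2] nf_conic_matrix(2)[of f3] f0 f3
    by (intro exI[of _ "nf_A f0 f1 f2"] exI[of _ "nf_B f3"]) (auto simp: complexify_nf \<phi>_def det_nf_pencil)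
qed

text \<open>Distinctness of the point sets says that the conics differ; for equal conics every
  trajectory stands still. In the second half the conics are chosen before solvability is
  assumed.\<close>

theorem proposition27:
  shows "(\<forall>(M\<^sub>A :: complex ^ 3 ^ 3) (M\<^sub>B :: complex ^ 3 ^ 3) (F :: complex poly) (R :: complex poly).
            conic_matrix M\<^sub>A \<and> conic_matrix M\<^sub>B \<and> conic_points M\<^sub>A \<noteq> conic_points M\<^sub>B \<and>
            (\<forall>z. poly F z = det (M\<^sub>A - mat z ** M\<^sub>B)) \<and> degree F = 3 \<and>
            (\<forall>t. t \<noteq> 0 \<longrightarrow> poly R t = t ^ 4 * poly F (1 / t)) \<and> degree R = 4 \<and>
            (\<exists>N. even N \<and> poncelet_periodic M\<^sub>A M\<^sub>B N)
            \<longrightarrow> pell_abel_solvable R)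
       \<and>
         (\<forall>(R :: real poly) (F :: real poly).
            degree R = 4 \<and> coeff R 0 = 0 \<and>
            (\<forall>s. s \<noteq> 0 \<longrightarrow> poly F s = s ^ 4 * poly R (1 / s)) \<and> degree F = 3
            \<longrightarrow> (\<exists>(M\<^sub>A :: real ^ 3 ^ 3) (M\<^sub>B :: real ^ 3 ^ 3).
                  conic_matrix M\<^sub>A \<and> conic_matrix M\<^sub>B \<and>
                  conic_points (complexify M\<^sub>A) \<noteq> conic_points (complexify M\<^sub>B) \<and>
                  (\<forall>z. det (M\<^sub>A - mat z ** M\<^sub>B) = poly F z) \<and>
                  (pell_abel_solvable (map_poly complex_of_real R) \<longrightarrow>
                    (\<exists>N. even N \<and> poncelet_periodic (complexify M\<^sub>A) (complexify M\<^sub>B) N))))"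
proof (intro conjI allI impI; (elim conjE)?)
  fix M\<^sub>A M\<^sub>B :: "complex ^ 3 ^ 3" and F R :: "complex poly"
  assume A: "conic_matrix M\<^sub>A" and B: "conic_matrix M\<^sub>B" and ne: "conic_points M\<^sub>A \<noteq> conic_points M\<^sub>B"
    and F: "\<forall>z. poly F z = det (M\<^sub>A - mat z ** M\<^sub>B)" "degree F = 3"
    and R: "\<forall>t. t \<noteq> 0 \<longrightarrow> poly R t = t ^ 4 * poly F (1 / t)" "degree R = 4"
    and "\<exists>N. even N \<and> poncelet_periodic M\<^sub>A M\<^sub>B N"
  then have "norm_solvable F"
    using conics_period_solves[OF A B ne] unfolding period_solves_def by blast
  then show "pell_abel_solvable R" using norm_solvable_imp_pell_abel[OF F(2)] R(1) by blast
next
  fix R F :: "real poly"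
  assume "degree R = 4" "coeff R 0 = 0" "\<forall>s. s \<noteq> 0 \<longrightarrow> poly F s = s ^ 4 * poly R (1 / s)" "degree F = 3"
  then show "\<exists>(M\<^sub>A :: real ^ 3 ^ 3) (M\<^sub>B :: real ^ 3 ^ 3).
                  conic_matrix M\<^sub>A \<and> conic_matrix M\<^sub>B \<and>
                  conic_points (complexify M\<^sub>A) \<noteq> conic_points (complexify M\<^sub>B) \<and>
                  (\<forall>z. det (M\<^sub>A - mat z ** M\<^sub>B) = poly F z) \<and>
                  (pell_abel_solvable (map_poly complex_of_real R) \<longrightarrow>
                    (\<exists>N. even N \<and> poncelet_periodic (complexify M\<^sub>A) (complexify M\<^sub>B) N))"
    using realize_by_conics by blast
qed

end
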